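(* Let $h$ denote the standard Euclidean metric on $\mathbb{R}^{m+1}$ and let $f$ be a positive smooth function on $\mathbb{R}^{m+1}$. Let $\phi: M^m\hookrightarrow (\mathbb{R}^{m+1}, h)$ be a minimal hypersurface with unit normal vector field $\xi$ (unit with respect to $h$), and let $g$ and $A$ be the induced metric and the shape operator of this minimal hypersurface $M^m\to(\mathbb{R}^{m+1},h)$. Then the hypersurface $\phi: M^m\hookrightarrow (\mathbb{R}^{m+1},f^{-2}h)$ in the conformally flat space is a biharmonic hypersurface if and only if $$\begin{cases} f\Delta_g(f(\xi f))-m\, (\mathrm{grad}_gf)(f(\xi f))-f^2(\xi f)|A|_h^2-2m(\xi f)^3+mf(\xi f)\, \mathrm{Hess}_h(f)(\xi, \xi)=0,\\ 2f A(\mathrm{grad}_g(\xi f))-2(m-1)(\xi f)A(\mathrm{grad}_gf)+(4-m)(\xi f)\,\mathrm{grad}_g(\xi f)=0. \end{cases}$$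
   Context: All manifolds, maps and tensor fields are smooth. A map $\varphi:(M,g)\to(N,h)$ between Riemannian manifolds is biharmonic if it is a critical point of the bienergy $\frac12\int_\Omega|\tau(\varphi)|^2$ for every compact $\Omega\subset M$, where $\tau(\varphi)=\mathrm{Trace}_g\nabla d\varphi$ is the tension field; equivalently $$\mathrm{Trace}_{g}(\nabla^{\varphi}\nabla^{\varphi}-\nabla^{\varphi}_{\nabla^{M}})\tau(\varphi)-\mathrm{Trace}_{g} R^{N}(d\varphi, \tau(\varphi))d\varphi=0,$$ with $R^{N}(X,Y)Z= [\nabla^{N}_{X},\nabla^{N}_{Y}]Z-\nabla^{N}_{[X,Y]}Z$. A hypersurface $M\to(N,h)$ is a biharmonic hypersurface if, with $M$ given the induced metric, the isometric immersion is a biharmonic map. Conventions: the shape operator is $AX=-\nabla_X\xi$, with $\nabla$ the flat connection of $h$, and $|A|_h^2=\mathrm{tr}(A^2)$. $\Delta_g$ and $\mathrm{grad}_g$ are the Laplacian (trace of the Hessian) and gradient on $(M,g)$, applied to functions restricted to $M$; $\mathrm{Hess}_h$ is the Euclidean Hessian; $\xi f$ is the derivative of $f$ in the direction $\xi$, a function on $M$; and $(\mathrm{grad}_g f)(u)=g(\mathrm{grad}_g f,\mathrm{grad}_g u)$ for a function $u$ on $M$. *)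

theory Defs
  imports "HOL-Analysis.Analysis"
begin

section \<open>Smooth functions and smooth manifolds\<close>

text \<open>The two predicates below are meant for open sets \<open>S\<close> only.\<close>

fun Ck_on :: "nat \<Rightarrow> 'a::real_normed_vector set \<Rightarrow> ('a \<Rightarrow> 'b::real_normed_vector) \<Rightarrow> bool" where
  "Ck_on 0 S F \<longleftrightarrow> continuous_on S F"
| "Ck_on (Suc k) S F \<longleftrightarrow> (\<forall>x\<in>S. F differentiable (at x)) \<and>
     (\<forall>v. Ck_on k S (\<lambda>x. frechet_derivative F (at x) v))"

definition smooth_on :: "'a::real_normed_vector set \<Rightarrow> ('a \<Rightarrow> 'b::real_normed_vector) \<Rightarrow> bool" where
  "smooth_on S F \<longleftrightarrow> (\<forall>k. Ck_on k S F)"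

text \<open>A chart is a pair of its domain and its coordinate map.  An atlas need not be maximal.\<close>

type_synonym ('a, 'm) chart = "'a set \<times> ('a \<Rightarrow> real ^ 'm)"

definition chart_image :: "('a, 'm) chart \<Rightarrow> (real ^ 'm) set" where
  "chart_image c = snd c ` fst c"

definition local_rep :: "('a, 'm) chart \<Rightarrow> ('a \<Rightarrow> 'b) \<Rightarrow> real ^ 'm \<Rightarrow> 'b" where
  "local_rep c F = F \<circ> inv_into (fst c) (snd c)"

definition smooth_manifold :: "'a topology \<Rightarrow> ('a, 'm::finite) chart set \<Rightarrow> bool" where
  "smooth_manifold M \<A> \<longleftrightarrow>
     Hausdorff_space M \<and> second_countable M \<and>
     (\<Union>c\<in>\<A>. fst c) = topspace M \<and>
     (\<forall>c\<in>\<A>. openin M (fst c) \<and> open (chart_image c) \<and>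
        homeomorphic_map (subtopology M (fst c)) (top_of_set (chart_image c)) (snd c)) \<and>
     (\<forall>c\<in>\<A>. \<forall>d\<in>\<A>. smooth_on (snd c ` (fst c \<inter> fst d)) (local_rep c (snd d)))"

definition smooth_map :: "('a, 'm::finite) chart set \<Rightarrow> ('a \<Rightarrow> 'b::real_normed_vector) \<Rightarrow> bool" where
  "smooth_map \<A> F \<longleftrightarrow> (\<forall>c\<in>\<A>. smooth_on (chart_image c) (local_rep c F))"

definition immersion :: "('a, 'm::finite) chart set \<Rightarrow> ('a \<Rightarrow> real ^ 'n) \<Rightarrow> bool" where
  "immersion \<A> \<phi> \<longleftrightarrow> smooth_map \<A> \<phi> \<and>
     (\<forall>c\<in>\<A>. \<forall>x\<in>chart_image c. inj (frechet_derivative (local_rep c \<phi>) (at x)))"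


section \<open>Riemannian geometry in coordinates\<close>

text \<open>A metric on an open subset of \<open>\<real>\<^sup>k\<close> is given by its Gram matrix in the standard coordinates.\<close>

type_synonym 'k metric = "real ^ 'k \<Rightarrow> real ^ 'k ^ 'k"

definition metric_inner :: "'k::finite metric \<Rightarrow> real ^ 'k \<Rightarrow> real ^ 'k \<Rightarrow> real ^ 'k \<Rightarrow> real" where
  "metric_inner G x u v = u \<bullet> (G x *v v)"

definition metric_trace :: "'k::finite metric \<Rightarrow> real ^ 'k \<Rightarrow> ('k \<Rightarrow> 'k \<Rightarrow> 'b::real_vector) \<Rightarrow> 'b" where
  "metric_trace G x B = (\<Sum>i\<in>UNIV. \<Sum>j\<in>UNIV. matrix_inv (G x) $ i $ j *\<^sub>R B i j)"

definition flat_metric :: "'k::finite metric" where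
  "flat_metric x = mat 1"

text \<open>The metric \<open>f\<^sup>-\<^sup>2 h\<close>, where \<open>h\<close> is the Euclidean metric.\<close>

definition conformal_metric :: "(real ^ 'k \<Rightarrow> real) \<Rightarrow> 'k::finite metric" where
  "conformal_metric f x = (1 / (f x)\<^sup>2) *\<^sub>R flat_metric x"

definition pd :: "'k::finite \<Rightarrow> (real ^ 'k \<Rightarrow> 'b::real_normed_vector) \<Rightarrow> real ^ 'k \<Rightarrow> 'b" where
  "pd i F x = frechet_derivative F (at x) (axis i 1)"

definition christoffel :: "'k::finite metric \<Rightarrow> 'k \<Rightarrow> 'k \<Rightarrow> 'k \<Rightarrow> real ^ 'k \<Rightarrow> real" where
  "christoffel G k i j x = (1 / 2) * (\<Sum>l\<in>UNIV. matrix_inv (G x) $ k $ l *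
     (pd i (\<lambda>y. G y $ j $ l) x + pd j (\<lambda>y. G y $ i $ l) x - pd l (\<lambda>y. G y $ i $ j) x))"

text \<open>The vector with components \<open>\<Gamma>\<^sup>k\<^sub>i\<^sub>j u\<^sup>i v\<^sup>j\<close>.\<close>

definition connection_term :: "'k::finite metric \<Rightarrow> real ^ 'k \<Rightarrow> real ^ 'k \<Rightarrow> real ^ 'k \<Rightarrow> real ^ 'k" where
  "connection_term G x u v = (\<chi> k. \<Sum>i\<in>UNIV. \<Sum>j\<in>UNIV. christoffel G k i j x * u $ i * v $ j)"

subsection \<open>Levi-Civita connection and curvature\<close>

definition covd :: "'k::finite metric \<Rightarrow> (real ^ 'k \<Rightarrow> real ^ 'k) \<Rightarrow> (real ^ 'k \<Rightarrow> real ^ 'k) \<Rightarrow> real ^ 'k \<Rightarrow> real ^ 'k" where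
  "covd G X Y x = frechet_derivative Y (at x) (X x) + connection_term G x (X x) (Y x)"

definition lie_bracket :: "(real ^ 'k \<Rightarrow> real ^ 'k) \<Rightarrow> (real ^ 'k \<Rightarrow> real ^ 'k) \<Rightarrow> real ^ 'k \<Rightarrow> real ^ 'k::finite" where
  "lie_bracket X Y x = frechet_derivative Y (at x) (X x) - frechet_derivative X (at x) (Y x)"

definition curvature :: "'k::finite metric \<Rightarrow> (real ^ 'k \<Rightarrow> real ^ 'k) \<Rightarrow> (real ^ 'k \<Rightarrow> real ^ 'k) \<Rightarrow>
    (real ^ 'k \<Rightarrow> real ^ 'k) \<Rightarrow> real ^ 'k \<Rightarrow> real ^ 'k" where
  "curvature G X Y Z x =
     covd G X (covd G Y Z) x - covd G Y (covd G X Z) x - covd G (lie_bracket X Y) Z x"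

text \<open>Curvature is tensorial, so its value on vectors at a point may be computed with any
  extension of these to vector fields; the constant extension is used.\<close>

definition curvature_at :: "'k::finite metric \<Rightarrow> real ^ 'k \<Rightarrow> real ^ 'k \<Rightarrow> real ^ 'k \<Rightarrow> real ^ 'k \<Rightarrow> real ^ 'k" where
  "curvature_at G x u v w = curvature G (\<lambda>_. u) (\<lambda>_. v) (\<lambda>_. w) x"

subsection \<open>Functions on a Riemannian manifold\<close>

definition gradient :: "'k::finite metric \<Rightarrow> (real ^ 'k \<Rightarrow> real) \<Rightarrow> real ^ 'k \<Rightarrow> real ^ 'k" where
  "gradient G u x = matrix_inv (G x) *v (\<chi> i. pd i u x)"

definition hessian :: "'k::finite metric \<Rightarrow> (real ^ 'k \<Rightarrow> real) \<Rightarrow> 'k \<Rightarrow> 'k \<Rightarrow> real ^ 'k \<Rightarrow> real" where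
  "hessian G u i j x = pd i (pd j u) x - (\<Sum>k\<in>UNIV. christoffel G k i j x * pd k u x)"

definition laplacian :: "'k::finite metric \<Rightarrow> (real ^ 'k \<Rightarrow> real) \<Rightarrow> real ^ 'k \<Rightarrow> real" where
  "laplacian G u x = metric_trace G x (\<lambda>i j. hessian G u i j x)"

definition euclidean_hessian :: "('b::real_normed_vector \<Rightarrow> real) \<Rightarrow> 'b \<Rightarrow> 'b \<Rightarrow> 'b \<Rightarrow> real" where
  "euclidean_hessian f y u v =
     frechet_derivative (\<lambda>z. frechet_derivative f (at z) v) (at y) u"


section \<open>Biharmonic maps\<close>

text \<open>Here \<open>g\<close> is a metric on an open subset of \<open>\<real>\<^sup>k\<close>, \<open>H\<close> a metric on \<open>\<real>\<^sup>n\<close>, \<open>F\<close> a map between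
  them and \<open>V\<close> a vector field along \<open>F\<close>.  The first definition is the pull-back connection
  \<open>\<nabla>\<^sup>F\<close> applied to \<open>V\<close> in the \<open>i\<close>-th coordinate direction.\<close>

definition cov_along :: "'n::finite metric \<Rightarrow> (real ^ 'k::finite \<Rightarrow> real ^ 'n) \<Rightarrow> 'k \<Rightarrow>
    (real ^ 'k \<Rightarrow> real ^ 'n) \<Rightarrow> real ^ 'k \<Rightarrow> real ^ 'n" where
  "cov_along H F i V x = pd i V x + connection_term H (F x) (pd i F x) (V x)"

definition tension :: "'k::finite metric \<Rightarrow> 'n::finite metric \<Rightarrow> (real ^ 'k \<Rightarrow> real ^ 'n) \<Rightarrow>
    real ^ 'k \<Rightarrow> real ^ 'n" where
  "tension g H F x = metric_trace g x
     (\<lambda>i j. cov_along H F i (pd j F) x - (\<Sum>k\<in>UNIV. christoffel g k i j x *\<^sub>R pd k F x))"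

definition rough_laplacian :: "'k::finite metric \<Rightarrow> 'n::finite metric \<Rightarrow> (real ^ 'k \<Rightarrow> real ^ 'n) \<Rightarrow>
    (real ^ 'k \<Rightarrow> real ^ 'n) \<Rightarrow> real ^ 'k \<Rightarrow> real ^ 'n" where
  "rough_laplacian g H F V x = metric_trace g x
     (\<lambda>i j. cov_along H F i (cov_along H F j V) x
        - (\<Sum>k\<in>UNIV. christoffel g k i j x *\<^sub>R cov_along H F k V x))"

definition bitension :: "'k::finite metric \<Rightarrow> 'n::finite metric \<Rightarrow> (real ^ 'k \<Rightarrow> real ^ 'n) \<Rightarrow>
    real ^ 'k \<Rightarrow> real ^ 'n" where
  "bitension g H F x = rough_laplacian g H F (tension g H F) x
     - metric_trace g x (\<lambda>i j. curvature_at H (F x) (pd i F x) (tension g H F x) (pd j F x))"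

text \<open>Biharmonicity is expressed by the Euler-Lagrange equation of the bienergy.  The metric \<open>g\<close>
  of the domain manifold is given by its Gram matrix in each chart.\<close>

definition biharmonic_map :: "('a, 'm::finite) chart set \<Rightarrow> (('a, 'm) chart \<Rightarrow> 'm metric) \<Rightarrow>
    'n::finite metric \<Rightarrow> ('a \<Rightarrow> real ^ 'n) \<Rightarrow> bool" where
  "biharmonic_map \<A> g H \<phi> \<longleftrightarrow>
     (\<forall>c\<in>\<A>. \<forall>x\<in>chart_image c. bitension (g c) H (local_rep c \<phi>) x = 0)"


section \<open>Hypersurfaces\<close>

definition induced_metric :: "'n::finite metric \<Rightarrow> ('a \<Rightarrow> real ^ 'n) \<Rightarrow> ('a, 'm::finite) chart \<Rightarrow> 'm metric" where
  "induced_metric H \<phi> c x = (\<chi> i j.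
     metric_inner H (local_rep c \<phi> x) (pd i (local_rep c \<phi>) x) (pd j (local_rep c \<phi>) x))"

definition biharmonic_hypersurface :: "('a, 'm::finite) chart set \<Rightarrow> 'n::finite metric \<Rightarrow>
    ('a \<Rightarrow> real ^ 'n) \<Rightarrow> bool" where
  "biharmonic_hypersurface \<A> H \<phi> \<longleftrightarrow> biharmonic_map \<A> (induced_metric H \<phi>) H \<phi>"

definition unit_normal_field :: "('a, 'm::finite) chart set \<Rightarrow> ('a \<Rightarrow> real ^ 'n::finite) \<Rightarrow>
    ('a \<Rightarrow> real ^ 'n) \<Rightarrow> bool" where
  "unit_normal_field \<A> \<phi> \<xi> \<longleftrightarrow> smooth_map \<A> \<xi> \<and>
     (\<forall>c\<in>\<A>. \<forall>p\<in>fst c. norm (\<xi> p) = 1 \<and>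
        (\<forall>v. frechet_derivative (local_rep c \<phi>) (at (snd c p)) v \<bullet> \<xi> p = 0))"

text \<open>The Euclidean shape operator \<open>A X = - \<nabla>\<^sub>X \<xi>\<close> at the point with coordinates \<open>x\<close>, acting on
  tangent vectors of the hypersurface written in the coordinates of the chart; the equation is
  stated in the ambient space, hence the differential of the immersion on the left.\<close>

definition shape_operator :: "('a \<Rightarrow> real ^ 'n::finite) \<Rightarrow> ('a \<Rightarrow> real ^ 'n) \<Rightarrow> ('a, 'm::finite) chart \<Rightarrow>
    real ^ 'm \<Rightarrow> real ^ 'm \<Rightarrow> real ^ 'm" where
  "shape_operator \<phi> \<xi> c x v = (THE w. frechet_derivative (local_rep c \<phi>) (at x) w
     = - frechet_derivative (local_rep c \<xi>) (at x) v)"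

definition mean_curvature :: "('a \<Rightarrow> real ^ 'n::finite) \<Rightarrow> ('a \<Rightarrow> real ^ 'n) \<Rightarrow> ('a, 'm::finite) chart \<Rightarrow>
    real ^ 'm \<Rightarrow> real" where
  "mean_curvature \<phi> \<xi> c x = trace (matrix (shape_operator \<phi> \<xi> c x)) / real CARD('m)"

definition minimal_hypersurface :: "('a, 'm::finite) chart set \<Rightarrow> ('a \<Rightarrow> real ^ 'n::finite) \<Rightarrow>
    ('a \<Rightarrow> real ^ 'n) \<Rightarrow> bool" where
  "minimal_hypersurface \<A> \<phi> \<xi> \<longleftrightarrow> (\<forall>c\<in>\<A>. \<forall>x\<in>chart_image c. mean_curvature \<phi> \<xi> c x = 0)"

text \<open>The function \<open>\<xi> f\<close> on the hypersurface.\<close>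

definition normal_derivative :: "(real ^ 'n::finite \<Rightarrow> real) \<Rightarrow> ('a \<Rightarrow> real ^ 'n) \<Rightarrow>
    ('a \<Rightarrow> real ^ 'n) \<Rightarrow> 'a \<Rightarrow> real" where
  "normal_derivative f \<phi> \<xi> p = frechet_derivative f (at (\<phi> p)) (\<xi> p)"

end

theory Submission
  imports Defs
begin

text \<open>In a chart everything reduces to an immersion \<open>F\<close> of an open set with unit normal \<open>\<xi>\<close>.  Put
  \<open>u = f \<circ> F\<close> and \<open>D = \<xi> f\<close>.  The Levi-Civita connection of \<open>f\<^sup>-\<^sup>2 h\<close> differs from the flat one by an
  algebraic term, and minimality turns the tension field into \<open>m u D \<xi>\<close>; its covariant derivative
  in the direction \<open>j\<close> is \<open>m (u D\<^sub>j \<xi> + u D \<xi>\<^sub>j - D\<^sup>2 F\<^sub>j)\<close>.  Taking the divergence requires only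
  \<open>\<Delta> F = 0\<close> and \<open>\<Delta> \<xi> = - |A|\<^sup>2 \<xi>\<close>, the latter obtained by differentiating \<open>tr A = 0\<close>.  Together with
  the explicit curvature of \<open>f\<^sup>-\<^sup>2 h\<close>, the bitension field comes out as \<open>m (u E\<^sub>1 \<xi> - u\<^sup>2 dF(E\<^sub>2))\<close> where
  \<open>E\<^sub>1\<close> and \<open>E\<^sub>2\<close> are the left-hand sides of the two equations.\<close>

section \<open>Calculus of smooth functions\<close>

text \<open>The conformal factor enters twice, through the ambient connection and through the
  induced metric on the domain. One formula for Christoffel symbols serves both, so that every trace
  is finally taken with the metric \<open>g\<close> induced from the flat space and every vector
  lives in that space. Identities between such vectors are checked by pairing with
  \<open>\<xi>\<close> and the coordinate tangent vectors, which replaces a separate calculus of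
  second fundamental forms. In the tension field the tangential corrections of the two sources
  cancel, as they must for an isometric immersion. Since \<open>u \<xi>\<close> is the unit normal
  of the conformal metric, \<open>D\<close> is its mean curvature function; this is why every term
  of the two equations contains \<open>D\<close> or a derivative of it. The delicate point is the
  tangential part of \<open>\<Delta> \<xi>\<close>: it needs the derivative of a trace formed with
  the inverse Gram matrix, which itself varies.\<close>

lemma Ck_on_cong:
  assumes "open S" "\<And>x. x \<in> S \<Longrightarrow> F x = G x" "Ck_on k S F"
  shows "Ck_on k S G"
  using assms(2,3)
proof (induction k arbitrary: F G)
  case 0
  then show ?case by (simp cong: continuous_on_cong)
next
  case (Suc k)
  \<comment> \<open>\<open>Ck_on\<close> iterates the total function
    \<open>frechet_derivative\<close>, whereas derivative formulas hold only on \<open>S\<close>.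
    The derivative depends on the germ alone, so openness lets such a formula replace it.\<close>
  have d: "(G has_derivative frechet_derivative F (at x)) (at x)" if "x \<in> S" for x
    using Suc.prems that assms(1)
    by (metis Ck_on.simps(2) frechet_derivative_works has_derivative_transform_within_open)
  have e: "frechet_derivative F (at x) = frechet_derivative G (at x)" if "x \<in> S" for x
    using d[OF that] by (rule frechet_derivative_at)
  have "Ck_on k S (\<lambda>x. frechet_derivative G (at x) v)" for v
    by (rule Suc.IH[of "\<lambda>x. frechet_derivative F (at x) v"]) (use e Suc.prems in auto)
  then show ?case using d by (auto simp: differentiable_def)
qed

lemma Ck_on_Suc_imp: "Ck_on (Suc k) S F \<Longrightarrow> Ck_on k S F"
proof (induction k arbitrary: F)
  case 0
  then show ?case
    by (auto intro!: continuous_at_imp_continuous_on differentiable_imp_continuous_within)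
next
  case (Suc k)
  then show ?case by (metis Ck_on.simps(2))
qed

lemma Ck_on_const: "Ck_on k S (\<lambda>_. c)"
  by (induction k arbitrary: c) auto

lemma Ck_on_add:
  assumes "open S" "Ck_on k S F" "Ck_on k S G"
  shows "Ck_on k S (\<lambda>x. F x + G x)"
  using assms(2,3)
proof (induction k arbitrary: F G)
  case 0
  then show ?case by (simp add: continuous_on_add)
next
  case (Suc k)
  have e: "frechet_derivative (\<lambda>x. F x + G x) (at x) v =
      frechet_derivative F (at x) v + frechet_derivative G (at x) v" if "x \<in> S" for x v
    using Suc.prems that
    by (auto simp: frechet_derivative_works intro!: frechet_derivative_at[symmetric, THEN fun_cong] has_derivative_add)
  have "Ck_on k S (\<lambda>x. frechet_derivative (\<lambda>x. F x + G x) (at x) v)" for v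
    by (rule Ck_on_cong[OF assms(1) e[symmetric] Suc.IH]) (use Suc.prems in auto)
  then show ?case using Suc.prems by auto
qed

lemma Ck_on_sum:
  assumes "open S" "\<And>i. i \<in> I \<Longrightarrow> Ck_on k S (F i)"
  shows "Ck_on k S (\<lambda>x. \<Sum>i\<in>I. F i x)"
  using assms(2)
proof (induction I rule: infinite_finite_induct)
qed (auto simp: Ck_on_const intro!: Ck_on_add assms(1))

text \<open>The product rule, proved once for scalar products and scalar multiples. The
  undifferentiated factor has one degree of smoothness to spare, which \<open>Ck_on_Suc_imp\<close>
  gives away.\<close>

lemma (in bounded_bilinear) Ck_on:
  assumes "open S" "Ck_on k S F" "Ck_on k S G"
  shows "Ck_on k S (\<lambda>x. prod (F x) (G x))"
  using assms(2,3)
proof (induction k arbitrary: F G)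
  case 0
  then show ?case by (simp add: continuous_on)
next
  case (Suc k)
  have d: "((\<lambda>x. prod (F x) (G x)) has_derivative
      (\<lambda>v. prod (F x) (frechet_derivative G (at x) v) + prod (frechet_derivative F (at x) v) (G x))) (at x)"
    if "x \<in> S" for x
    using Suc.prems that by (intro FDERIV) (auto simp: frechet_derivative_works)
  have "Ck_on k S (\<lambda>x. frechet_derivative (\<lambda>x. prod (F x) (G x)) (at x) v)" for v
    by (rule Ck_on_cong[OF assms(1) frechet_derivative_at[OF d, THEN fun_cong]],
        assumption, intro Ck_on_add Suc.IH)
      (use Suc.prems assms in \<open>auto intro: Ck_on_Suc_imp\<close>)
  then show ?case using d by (auto simp: differentiable_def)
qed

lemma Ck_on_compose:
  fixes F :: "'a::real_normed_vector \<Rightarrow> 'b::euclidean_space" and G :: "'b \<Rightarrow> 'c::real_normed_vector"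
  assumes "open S" "Ck_on k S F" "Ck_on k T G" "F ` S \<subseteq> T"
  shows "Ck_on k S (\<lambda>x. G (F x))"
  using assms(2,3)
proof (induction k arbitrary: G)
  case 0
  then show ?case using continuous_on_compose2[of T G S F] assms(4) by simp
next
  case (Suc k)
  have d: "((\<lambda>x. G (F x)) has_derivative
      (\<lambda>v. frechet_derivative G (at (F x)) (frechet_derivative F (at x) v))) (at x)" if "x \<in> S" for x
    using Suc.prems that assms(4) diff_chain_at[of F "frechet_derivative F (at x)" x G]
    by (auto simp: frechet_derivative_works o_def)
  \<comment> \<open>In the chain rule the direction inserted into the derivative of \<open>G\<close>
    varies with \<open>x\<close>, but \<open>Ck_on\<close> knows only fixed directions. Expanding it
    in the basis leaves fixed directions with coefficients of class \<open>k\<close>.\<close>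
  have e: "(\<Sum>b\<in>Basis. (frechet_derivative F (at x) v \<bullet> b) *\<^sub>R frechet_derivative G (at (F x)) b) =
      frechet_derivative (\<lambda>x. G (F x)) (at x) v" (is "?L x v = _") if "x \<in> S" for x v
  proof -
    have "linear (frechet_derivative G (at (F x)))"
      using Suc.prems that assms(4) by (intro linear_frechet_derivative) auto
    then have "?L x v = frechet_derivative G (at (F x)) (\<Sum>b\<in>Basis. (frechet_derivative F (at x) v \<bullet> b) *\<^sub>R b)"
      by (simp add: linear_sum linear_cmul)
    then show ?thesis
      by (simp add: euclidean_representation flip: frechet_derivative_at[OF d[OF that]])
  qed
  have "Ck_on k S (\<lambda>x. frechet_derivative (\<lambda>x. G (F x)) (at x) v)" for v
  proof (rule Ck_on_cong[OF assms(1) e], assumption,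
      intro Ck_on_sum assms(1) bounded_bilinear.Ck_on[OF bounded_bilinear_scaleR]
        bounded_bilinear.Ck_on[OF bounded_bilinear_inner] Suc.IH Ck_on_const)
  qed (use Suc.prems Ck_on_Suc_imp in auto)
  then show ?case using d by (auto simp: differentiable_def)
qed

lemma smooth_on_const: "smooth_on S (\<lambda>_. c)"
  by (simp add: smooth_on_def Ck_on_const)

lemma smooth_on_sum:
  "open S \<Longrightarrow> (\<And>i. i \<in> I \<Longrightarrow> smooth_on S (F i)) \<Longrightarrow> smooth_on S (\<lambda>x. \<Sum>i\<in>I. F i x)"
  by (simp add: smooth_on_def Ck_on_sum)

lemma smooth_on_inner:
  "open S \<Longrightarrow> smooth_on S F \<Longrightarrow> smooth_on S G \<Longrightarrow> smooth_on S (\<lambda>x. F x \<bullet> G x)"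
  by (simp add: smooth_on_def bounded_bilinear.Ck_on[OF bounded_bilinear_inner])

lemma smooth_on_scaleR:
  "open S \<Longrightarrow> smooth_on S F \<Longrightarrow> smooth_on S G \<Longrightarrow> smooth_on S (\<lambda>x. F x *\<^sub>R G x)"
  by (simp add: smooth_on_def bounded_bilinear.Ck_on[OF bounded_bilinear_scaleR])

lemma smooth_on_compose:
  fixes F :: "'a::real_normed_vector \<Rightarrow> 'b::euclidean_space"
  shows "open S \<Longrightarrow> smooth_on S F \<Longrightarrow> smooth_on UNIV G \<Longrightarrow> smooth_on S (\<lambda>x. G (F x))"
  using Ck_on_compose[of S _ F UNIV G] by (simp add: smooth_on_def)

lemma smooth_on_frechet_derivative: "smooth_on S F \<Longrightarrow> smooth_on S (\<lambda>x. frechet_derivative F (at x) v)"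
  unfolding smooth_on_def using Ck_on.simps(2) by blast

lemma smooth_on_pd: "smooth_on S F \<Longrightarrow> smooth_on S (pd i F)"
  unfolding pd_def[abs_def] by (rule smooth_on_frechet_derivative)

lemma smooth_on_differentiable: "smooth_on S F \<Longrightarrow> x \<in> S \<Longrightarrow> F differentiable (at x)"
  unfolding smooth_on_def using Ck_on.simps(2) by blast

lemma smooth_on_imp_continuous_on: "smooth_on S F \<Longrightarrow> continuous_on S F"
  unfolding smooth_on_def using Ck_on.simps(1) by blast

section \<open>Symmetry of second derivatives\<close>

abbreviation dir_deriv :: "'a::real_normed_vector \<Rightarrow> ('a \<Rightarrow> 'b::real_normed_vector) \<Rightarrow> 'a \<Rightarrow> 'b" where
  "dir_deriv v u x \<equiv> frechet_derivative u (at x) v"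

lemma has_real_derivative_along_line:
  fixes u :: "'a::real_normed_vector \<Rightarrow> real"
  assumes "u differentiable (at (y + s *\<^sub>R v))"
  shows "((\<lambda>s. u (y + s *\<^sub>R v)) has_real_derivative dir_deriv v u (y + s *\<^sub>R v)) (at s)"
proof -
  have 1: "((\<lambda>s. y + s *\<^sub>R v) has_derivative (\<lambda>h. h *\<^sub>R v)) (at s)"
    by (auto intro!: derivative_eq_intros)
  have "(u has_derivative frechet_derivative u (at (y + s *\<^sub>R v))) (at (y + s *\<^sub>R v))"
    using assms by (simp add: frechet_derivative_works)
  from diff_chain_at[OF 1 this] have 2: "((\<lambda>s. u (y + s *\<^sub>R v)) has_derivative
     (\<lambda>h. frechet_derivative u (at (y + s *\<^sub>R v)) (h *\<^sub>R v))) (at s)" by (simp add: o_def)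
  have "frechet_derivative u (at (y + s *\<^sub>R v)) (h *\<^sub>R v) = dir_deriv v u (y + s *\<^sub>R v) * h" for h
    using linear_cmul[OF linear_frechet_derivative[OF assms]] by simp
  then show ?thesis using 2 by (simp add: has_field_derivative_def)
qed

text \<open>The mean value theorem is applied twice: along \<open>v\<close> to the difference of
  \<open>u\<close> between two parallel edges of the square, then along \<open>w\<close> to the
  derivative so obtained. The second difference is symmetric in \<open>v\<close> and
  \<open>w\<close>, and this is the source of the symmetry of second derivatives.\<close>

lemma second_difference_mvt:
  fixes u :: "'a::real_normed_vector \<Rightarrow> real"
  assumes u: "smooth_on S u" and t: "t > 0"
    and S: "\<And>a b. \<lbrakk>0 \<le> a; a \<le> t; 0 \<le> b; b \<le> t\<rbrakk> \<Longrightarrow> x + a *\<^sub>R v + b *\<^sub>R w \<in> S"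
  shows "\<exists>a b. 0 \<le> a \<and> a \<le> t \<and> 0 \<le> b \<and> b \<le> t \<and>
    u (x + t *\<^sub>R v + t *\<^sub>R w) - u (x + t *\<^sub>R v) - u (x + t *\<^sub>R w) + u x =
    t\<^sup>2 * dir_deriv w (dir_deriv v u) (x + a *\<^sub>R v + b *\<^sub>R w)"
proof -
  let ?p = "\<lambda>a. u ((x + t *\<^sub>R w) + a *\<^sub>R v) - u (x + a *\<^sub>R v)"
  have "\<exists>a>0. a < t \<and> ?p t - ?p 0 =
      (t - 0) * (dir_deriv v u ((x + t *\<^sub>R w) + a *\<^sub>R v) - dir_deriv v u (x + a *\<^sub>R v))"
  proof (rule MVT2[OF t])
    fix a assume a: "0 \<le> a" "a \<le> t"
    have "x + t *\<^sub>R w + a *\<^sub>R v \<in> S" using S[of a t] a t by (simp add: algebra_simps)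
    moreover have "x + a *\<^sub>R v \<in> S" using S[of a 0] a t by simp
    ultimately show "(?p has_real_derivative
        dir_deriv v u ((x + t *\<^sub>R w) + a *\<^sub>R v) - dir_deriv v u (x + a *\<^sub>R v)) (at a)"
      by (intro DERIV_diff has_real_derivative_along_line smooth_on_differentiable[OF u])
  qed
  then obtain a where a: "0 < a" "a < t" and 1: "?p t - ?p 0 =
      t * (dir_deriv v u ((x + t *\<^sub>R w) + a *\<^sub>R v) - dir_deriv v u (x + a *\<^sub>R v))" by auto
  let ?q = "\<lambda>b. dir_deriv v u ((x + a *\<^sub>R v) + b *\<^sub>R w)"
  have "\<exists>b>0. b < t \<and> ?q t - ?q 0 = (t - 0) * dir_deriv w (dir_deriv v u) ((x + a *\<^sub>R v) + b *\<^sub>R w)"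
  proof (rule MVT2[OF t])
    fix b assume b: "0 \<le> b" "b \<le> t"
    show "(?q has_real_derivative dir_deriv w (dir_deriv v u) ((x + a *\<^sub>R v) + b *\<^sub>R w)) (at b)"
      by (intro has_real_derivative_along_line smooth_on_differentiable[OF smooth_on_frechet_derivative[OF u]] S)
        (use a b in auto)
  qed
  then obtain b where b: "0 < b" "b < t" and
    2: "?q t - ?q 0 = t * dir_deriv w (dir_deriv v u) (x + a *\<^sub>R v + b *\<^sub>R w)" by auto
  have 3: "?q t = dir_deriv v u ((x + t *\<^sub>R w) + a *\<^sub>R v)" by (simp add: algebra_simps)
  have "?p t - ?p 0 = t * (?q t - ?q 0)" unfolding 1 3 by simp
  also have "\<dots> = t\<^sup>2 * dir_deriv w (dir_deriv v u) (x + a *\<^sub>R v + b *\<^sub>R w)"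
    unfolding 2 by (simp add: power2_eq_square)
  finally show ?thesis using a b
    by (intro exI[of _ a] exI[of _ b]) (simp add: algebra_simps)
qed

lemma dir_deriv_commute_real:
  fixes u :: "'a::real_normed_vector \<Rightarrow> real"
  assumes "open S" "smooth_on S u" "x \<in> S"
  shows "dir_deriv v (dir_deriv w u) x = dir_deriv w (dir_deriv v u) x"
proof (rule ccontr)
  assume neq: "\<not> ?thesis"
  \<comment> \<open>Half of the supposed gap. The second difference is the same for both orders of
    the directions, so the mixed derivatives agree at two points near \<open>x\<close>, and by
    continuity each is within \<open>e\<close> of its value at \<open>x\<close>.\<close>
  define e where "e = \<bar>dir_deriv v (dir_deriv w u) x - dir_deriv w (dir_deriv v u) x\<bar> / 2"
  have e: "e > 0" using neq by (simp add: e_def)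
  have "continuous_on S (dir_deriv v (dir_deriv w u))" "continuous_on S (dir_deriv w (dir_deriv v u))"
    by (intro smooth_on_imp_continuous_on smooth_on_frechet_derivative assms)+
  then have "isCont (dir_deriv v (dir_deriv w u)) x" "isCont (dir_deriv w (dir_deriv v u)) x"
    using assms continuous_on_eq_continuous_at by blast+
  then obtain d1 d2 where d1: "d1 > 0" "\<And>y. dist y x < d1 \<Longrightarrow>
        dist (dir_deriv v (dir_deriv w u) y) (dir_deriv v (dir_deriv w u) x) < e"
    and d2: "d2 > 0" "\<And>y. dist y x < d2 \<Longrightarrow>
        dist (dir_deriv w (dir_deriv v u) y) (dir_deriv w (dir_deriv v u) x) < e"
    using e unfolding continuous_at_eps_delta by metis
  obtain d3 where d3: "d3 > 0" "ball x d3 \<subseteq> S" using assms open_contains_ball by blast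
  define d where "d = min d1 (min d2 d3)"
  \<comment> \<open>The summand 1 keeps \<open>N\<close> positive when both directions vanish; the
    side \<open>t\<close> then moves points by at most t N = d / 2.\<close>
  define N where "N = norm v + norm w + 1"
  have N: "N > 0" by (simp add: N_def add_nonneg_pos)
  define t where "t = d / (2 * N)"
  have d: "d > 0" using d1 d2 d3 by (simp add: d_def)
  then have t: "t > 0" using N by (simp add: t_def)
  have dst: "dist (x + a *\<^sub>R v + b *\<^sub>R w) x < d" if "0 \<le> a" "a \<le> t" "0 \<le> b" "b \<le> t" for a b
  proof -
    have "dist (x + a *\<^sub>R v + b *\<^sub>R w) x \<le> a * norm v + b * norm w"
      using that norm_triangle_ineq[of "a *\<^sub>R v" "b *\<^sub>R w"] by (simp add: dist_norm add.assoc)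
    also have "\<dots> \<le> t * norm v + t * norm w" using that by (intro add_mono mult_right_mono) auto
    also have "\<dots> \<le> t * N" using t by (simp add: N_def algebra_simps)
    also have "\<dots> < d" using d N by (simp add: t_def)
    finally show ?thesis .
  qed
  have S: "x + a *\<^sub>R v + b *\<^sub>R w \<in> S" "x + b *\<^sub>R w + a *\<^sub>R v \<in> S"
    if "0 \<le> a" "a \<le> t" "0 \<le> b" "b \<le> t" for a b
    using dst[OF that] d3 by (auto simp: d_def dist_commute subset_iff add_ac)
  obtain a b where ab: "0 \<le> a" "a \<le> t" "0 \<le> b" "b \<le> t" and
    1: "u (x + t *\<^sub>R v + t *\<^sub>R w) - u (x + t *\<^sub>R v) - u (x + t *\<^sub>R w) + u x =
      t\<^sup>2 * dir_deriv w (dir_deriv v u) (x + a *\<^sub>R v + b *\<^sub>R w)"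
    using second_difference_mvt[OF assms(2) t, of x v w] S by blast
  obtain a' b' where ab': "0 \<le> a'" "a' \<le> t" "0 \<le> b'" "b' \<le> t" and
    2: "u (x + t *\<^sub>R w + t *\<^sub>R v) - u (x + t *\<^sub>R w) - u (x + t *\<^sub>R v) + u x =
      t\<^sup>2 * dir_deriv v (dir_deriv w u) (x + b' *\<^sub>R w + a' *\<^sub>R v)"
    using second_difference_mvt[OF assms(2) t, of x w v] S by blast
  have "t\<^sup>2 * dir_deriv w (dir_deriv v u) (x + a *\<^sub>R v + b *\<^sub>R w) =
      t\<^sup>2 * dir_deriv v (dir_deriv w u) (x + a' *\<^sub>R v + b' *\<^sub>R w)"
    using 1 2 by (simp add: algebra_simps)
  then have "dir_deriv w (dir_deriv v u) (x + a *\<^sub>R v + b *\<^sub>R w) =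
      dir_deriv v (dir_deriv w u) (x + a' *\<^sub>R v + b' *\<^sub>R w)" using t by simp
  moreover have "dist (dir_deriv w (dir_deriv v u) (x + a *\<^sub>R v + b *\<^sub>R w)) (dir_deriv w (dir_deriv v u) x) < e"
    using dst[OF ab] by (intro d2) (simp add: d_def)
  moreover have "dist (dir_deriv v (dir_deriv w u) (x + a' *\<^sub>R v + b' *\<^sub>R w)) (dir_deriv v (dir_deriv w u) x) < e"
    using dst[OF ab'] by (intro d1) (simp add: d_def)
  ultimately have "\<bar>dir_deriv v (dir_deriv w u) x - dir_deriv w (dir_deriv v u) x\<bar> < e + e"
    unfolding dist_real_def by (smt (verit))
  then show False by (simp add: e_def)
qed

lemma dir_deriv_commute:
  fixes u :: "'a::real_normed_vector \<Rightarrow> 'b::euclidean_space"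
  assumes "open S" "smooth_on S u" "x \<in> S"
  shows "dir_deriv v (dir_deriv w u) x = dir_deriv w (dir_deriv v u) x"
proof (rule euclidean_eqI)
  fix b :: 'b
  have in1: "dir_deriv a (\<lambda>y. F y \<bullet> b) y = dir_deriv a F y \<bullet> b"
    if "smooth_on S F" "y \<in> S" for F :: "'a \<Rightarrow> 'b" and a y
    using that smooth_on_differentiable[OF that]
    by (auto simp: frechet_derivative_works
        intro!: frechet_derivative_at[symmetric, THEN fun_cong] has_derivative_inner_left)
  have in2: "dir_deriv p (dir_deriv q (\<lambda>y. u y \<bullet> b)) x = dir_deriv p (dir_deriv q u) x \<bullet> b" for p q
  proof -
    have sm: "smooth_on S (\<lambda>y. dir_deriv q u y \<bullet> b)"
      by (intro smooth_on_inner smooth_on_frechet_derivative smooth_on_const assms)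
    have "dir_deriv p (\<lambda>y. dir_deriv q u y \<bullet> b) x = dir_deriv p (dir_deriv q (\<lambda>y. u y \<bullet> b)) x"
      by (rule fun_cong[OF frechet_derivative_transform_within_open[OF
            smooth_on_differentiable[OF sm assms(3)] assms(1,3)]]) (simp add: in1[OF assms(2)])
    then show ?thesis using in1[OF smooth_on_frechet_derivative[OF assms(2)] assms(3)] by simp
  qed
  have "smooth_on S (\<lambda>y. u y \<bullet> b)" by (intro smooth_on_inner smooth_on_const assms)
  from dir_deriv_commute_real[OF assms(1) this assms(3), of v w]
  show "dir_deriv v (dir_deriv w u) x \<bullet> b = dir_deriv w (dir_deriv v u) x \<bullet> b" unfolding in2 by simp
qed

section \<open>Conformal changes of metric\<close>

lemma pd_eqI: "(F has_derivative F') (at x) \<Longrightarrow> pd i F x = F' (axis i 1)"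
  unfolding pd_def by (simp flip: frechet_derivative_at)

lemma pd_cong:
  assumes "F differentiable (at x)" "open S" "x \<in> S" "\<And>y. y \<in> S \<Longrightarrow> F y = G y"
  shows "pd i F x = pd i G x"
  unfolding pd_def using frechet_derivative_transform_within_open[OF assms] by simp

lemma pd_add:
  "F differentiable (at x) \<Longrightarrow> G differentiable (at x) \<Longrightarrow> pd i (\<lambda>y. F y + G y) x = pd i F x + pd i G x"
  unfolding frechet_derivative_works by (subst pd_eqI, rule has_derivative_add) (auto simp: pd_def)

lemma pd_diff:
  "F differentiable (at x) \<Longrightarrow> G differentiable (at x) \<Longrightarrow> pd i (\<lambda>y. F y - G y) x = pd i F x - pd i G x"
  unfolding frechet_derivative_works by (subst pd_eqI, rule has_derivative_diff) (auto simp: pd_def)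

lemma pd_scaleR:
  "F differentiable (at x) \<Longrightarrow> G differentiable (at x) \<Longrightarrow>
    pd i (\<lambda>y. F y *\<^sub>R G y) x = F x *\<^sub>R pd i G x + pd i F x *\<^sub>R G x"
  unfolding frechet_derivative_works by (subst pd_eqI, rule has_derivative_scaleR) (auto simp: pd_def)

lemma pd_mult:
  fixes F G :: "_ \<Rightarrow> real"
  shows "F differentiable (at x) \<Longrightarrow> G differentiable (at x) \<Longrightarrow>
    pd i (\<lambda>y. F y * G y) x = F x * pd i G x + pd i F x * G x"
  using pd_scaleR[of F x G i] by simp

lemma pd_inner:
  "F differentiable (at x) \<Longrightarrow> G differentiable (at x) \<Longrightarrow>
    pd i (\<lambda>y. F y \<bullet> G y) x = F x \<bullet> pd i G x + pd i F x \<bullet> G x"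
  unfolding frechet_derivative_works by (subst pd_eqI, rule has_derivative_inner) (auto simp: pd_def)

lemma pd_const [simp]: "pd i (\<lambda>_. c) x = 0"
  by (simp add: pd_def)

lemma pd_sum:
  "(\<And>a. a \<in> I \<Longrightarrow> F a differentiable (at x)) \<Longrightarrow> pd i (\<lambda>y. \<Sum>a\<in>I. F a y) x = (\<Sum>a\<in>I. pd i (F a) x)"
  unfolding frechet_derivative_works by (subst pd_eqI, rule has_derivative_sum) (auto simp: pd_def)

lemma linear_eq_sum_axis:
  fixes K :: "real ^ 'k::finite \<Rightarrow> 'b::real_vector"
  assumes "linear K"
  shows "K v = (\<Sum>i\<in>UNIV. v $ i *\<^sub>R K (axis i 1))"
proof -
  have "v = (\<Sum>i\<in>UNIV. v $ i *\<^sub>R axis i 1)"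
    using basis_expansion[of v] by (simp add: scalar_mult_eq_scaleR)
  then have "K v = K (\<Sum>i\<in>UNIV. v $ i *\<^sub>R axis i 1)" by simp
  then show ?thesis by (simp add: linear_sum[OF assms] linear_cmul[OF assms])
qed

lemma frechet_derivative_eq_sum_pd:
  "F differentiable (at x) \<Longrightarrow> frechet_derivative F (at x) v = (\<Sum>i\<in>UNIV. v $ i *\<^sub>R pd i F x)"
  unfolding pd_def by (rule linear_eq_sum_axis[OF linear_frechet_derivative])

section \<open>Inverse Gram matrices and metric traces\<close>

lemma matrix_inv_inverse:
  fixes A :: "real ^ 'k ^ 'k::finite"
  assumes "invertible A"
  shows "A ** matrix_inv A = mat 1" "matrix_inv A ** A = mat 1"
proof -
  have "\<exists>B. A ** B = mat 1 \<and> B ** A = mat 1" using assms unfolding invertible_def .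
  then have "A ** matrix_inv A = mat 1 \<and> matrix_inv A ** A = mat 1"
    unfolding matrix_inv_def by (rule someI_ex)
  then show "A ** matrix_inv A = mat 1" "matrix_inv A ** A = mat 1" by auto
qed

lemma matrix_inv_unique_right:
  fixes A B :: "real ^ 'k ^ 'k::finite"
  assumes "A ** B = mat 1"
  shows "matrix_inv A = B"
proof -
  have "invertible A" using assms invertible_right_inverse by blast
  from matrix_inv_inverse(2)[OF this] show ?thesis
    by (metis assms matrix_mul_assoc matrix_mul_lid matrix_mul_rid)
qed

lemma matrix_inv_scaleR:
  fixes A :: "real ^ 'k ^ 'k::finite"
  assumes "invertible A" "c \<noteq> 0"
  shows "matrix_inv (c *\<^sub>R A) = (1 / c) *\<^sub>R matrix_inv A"
proof (rule matrix_inv_unique_right)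
  have "(c *\<^sub>R A) ** ((1 / c) *\<^sub>R matrix_inv A) = A ** matrix_inv A"
    using assms(2) by (simp add: vec_eq_iff matrix_matrix_mult_def mult_ac)
  then show "(c *\<^sub>R A) ** ((1 / c) *\<^sub>R matrix_inv A) = mat 1"
    by (simp add: matrix_inv_inverse[OF assms(1)])
qed

lemma matrix_inv_symmetric:
  fixes A :: "real ^ 'k ^ 'k::finite"
  assumes "invertible A" "transpose A = A"
  shows "matrix_inv A $ i $ j = matrix_inv A $ j $ i"
proof -
  have "transpose (matrix_inv A ** A) = mat 1"
    by (simp only: matrix_inv_inverse[OF assms(1)] transpose_mat)
  then have "A ** transpose (matrix_inv A) = mat 1"
    by (simp only: matrix_transpose_mul assms(2))
  then have "matrix_inv A = transpose (matrix_inv A)" by (rule matrix_inv_unique_right)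
  then show ?thesis by (simp add: vec_eq_iff transpose_def)
qed

lemma metric_trace_add:
  "metric_trace G x (\<lambda>i j. B i j + C i j) = metric_trace G x B + metric_trace G x C"
  by (simp add: metric_trace_def scaleR_add_right sum.distrib)

lemma metric_trace_diff:
  "metric_trace G x (\<lambda>i j. B i j - C i j) = metric_trace G x B - metric_trace G x C"
  by (simp add: metric_trace_def scaleR_diff_right sum_subtractf)

lemma metric_trace_linear:
  "linear K \<Longrightarrow> metric_trace G x (\<lambda>i j. K (B i j)) = K (metric_trace G x B)"
  by (simp add: metric_trace_def linear_sum linear_cmul)

lemma metric_trace_scaleR: "metric_trace G x (\<lambda>i j. c *\<^sub>R B i j) = c *\<^sub>R metric_trace G x B"
  by (intro metric_trace_linear) (simp add: linear_iff scaleR_add_right mult.commute)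

lemma metric_trace_mult: "metric_trace G x (\<lambda>i j. c * B i j) = c * (metric_trace G x B :: real)"
  using metric_trace_scaleR[of G x c B] by simp

lemma metric_trace_scaleR_left: "metric_trace G x (\<lambda>i j. B i j *\<^sub>R v) = metric_trace G x B *\<^sub>R v"
  using metric_trace_linear[of "\<lambda>a. a *\<^sub>R v" G x B] by (simp add: linear_iff scaleR_add_left)

lemma metric_trace_inner_left: "metric_trace G x (\<lambda>i j. B i j \<bullet> v) = metric_trace G x B \<bullet> v"
  by (rule metric_trace_linear[of "\<lambda>a. a \<bullet> v" G x B]) (simp add: linear_iff inner_add_left)

text \<open>Index calculus at a single point. It is applied to the flat metric of the ambient space
  and to the metric induced from it on the hypersurface.\<close>

locale riemannian_point =
  fixes G :: "'k::finite metric" and x :: "real ^ 'k"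
  assumes invertible: "invertible (G x)" and symmetric: "G x $ i $ j = G x $ j $ i"
begin

lemma inv_symmetric: "matrix_inv (G x) $ i $ j = matrix_inv (G x) $ j $ i"
  by (rule matrix_inv_symmetric[OF invertible]) (simp add: vec_eq_iff transpose_def symmetric)

lemma sum_inv_left: "(\<Sum>l\<in>UNIV. matrix_inv (G x) $ k $ l * G x $ l $ j) = (if k = j then 1 else 0)"
  using arg_cong[OF matrix_inv_inverse(2)[OF invertible], of "\<lambda>M. M $ k $ j"]
  by (simp add: matrix_matrix_mult_def mat_def)

lemma trace_swap: "metric_trace G x (\<lambda>i j. B j i) = metric_trace G x B"
proof -
  have "metric_trace G x (\<lambda>i j. B j i) = (\<Sum>j\<in>UNIV. \<Sum>i\<in>UNIV. matrix_inv (G x) $ j $ i *\<^sub>R B j i)"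
    unfolding metric_trace_def by (subst sum.swap) (simp add: inv_symmetric)
  then show ?thesis by (simp add: metric_trace_def)
qed

text \<open>Contracting a covector with a linear map amounts to raising its index first. The map
  will be the differential of the immersion or of its normal, which yields gradients and their
  images under the shape operator.\<close>

lemma trace_scaleR_linear:
  assumes "linear K"
  shows "metric_trace G x (\<lambda>i j. a i *\<^sub>R K (axis j 1)) = K (matrix_inv (G x) *v (\<chi> i. a i))"
    "metric_trace G x (\<lambda>i j. a j *\<^sub>R K (axis i 1)) = K (matrix_inv (G x) *v (\<chi> i. a i))"
proof -
  show "metric_trace G x (\<lambda>i j. a j *\<^sub>R K (axis i 1)) = K (matrix_inv (G x) *v (\<chi> i. a i))"
    unfolding metric_trace_def
    by (subst linear_eq_sum_axis[OF assms, of "matrix_inv (G x) *v _"])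
      (simp add: matrix_vector_mult_def scaleR_sum_left)
  then show "metric_trace G x (\<lambda>i j. a i *\<^sub>R K (axis j 1)) = K (matrix_inv (G x) *v (\<chi> i. a i))"
    by (subst trace_swap)
qed

lemma trace_metric: "metric_trace G x (\<lambda>i j. G x $ i $ j) = real CARD('k)"
proof -
  have "metric_trace G x (\<lambda>i j. G x $ i $ j) = (\<Sum>i\<in>UNIV. \<Sum>j\<in>UNIV. matrix_inv (G x) $ i $ j * G x $ j $ i)"
    by (simp add: metric_trace_def symmetric)
  then show ?thesis by (simp add: sum_inv_left)
qed

lemma trace_prod:
  "metric_trace G x (\<lambda>i j. pd i u x * pd j v x) = metric_inner G x (gradient G u x) (gradient G v x)"
proof -
  have "G x *v gradient G v x = (\<chi> i. pd i v x)"
    unfolding gradient_def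
    by (simp add: matrix_vector_mul_assoc matrix_inv_inverse[OF invertible])
  then have "metric_inner G x (gradient G u x) (gradient G v x) =
      (\<Sum>j\<in>UNIV. (\<Sum>i\<in>UNIV. matrix_inv (G x) $ j $ i * pd i u x) * pd j v x)"
    by (simp add: metric_inner_def inner_vec_def) (simp add: gradient_def matrix_vector_mult_def)
  also have "\<dots> = metric_trace G x (\<lambda>i j. pd j u x * pd i v x)"
    by (simp add: metric_trace_def sum_distrib_left sum_distrib_right mult_ac)
  also have "\<dots> = metric_trace G x (\<lambda>i j. pd i u x * pd j v x)"
    by (subst trace_swap) simp
  finally show ?thesis by simp
qed

text \<open>The classical formula for a metric \<open>exp (2 * w)\<close> times \<open>G\<close>,
  here with dw = - du / u. It is used for the ambient metric with \<open>f\<close> in the role of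
  \<open>u\<close> and for the induced metric with the restriction of \<open>f\<close>.\<close>

lemma christoffel_conformal:
  assumes h: "\<And>y. h y = (1 / (u y)\<^sup>2) *\<^sub>R G y" and u: "u differentiable (at x)" "u x \<noteq> 0"
    and G: "\<And>i j. (\<lambda>y. G y $ i $ j) differentiable (at x)"
  shows "christoffel h k i j x = christoffel G k i j x -
    (pd i u x * (if k = j then 1 else 0) + pd j u x * (if k = i then 1 else 0)
      - G x $ i $ j * gradient G u x $ k) / u x"
proof -
  have p: "pd a (\<lambda>y. h y $ b $ c) x = pd a (\<lambda>y. G y $ b $ c) x / (u x)\<^sup>2 - 2 * pd a u x * G x $ b $ c / (u x)^3"
    for a b c
  proof -
    have "((\<lambda>y. h y $ b $ c) has_derivative (\<lambda>v. frechet_derivative (\<lambda>y. G y $ b $ c) (at x) v / (u x)\<^sup>2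
        - 2 * frechet_derivative u (at x) v * G x $ b $ c / (u x)^3)) (at x)"
      unfolding h vector_scaleR_component real_scaleR_def using u G[of b c] unfolding frechet_derivative_works
      by (auto intro!: derivative_eq_intros simp: field_simps power2_eq_square power3_eq_cube)
    from pd_eqI[OF this] show ?thesis by (simp add: pd_def)
  qed
  have s: "(\<Sum>l\<in>UNIV. matrix_inv (G x) $ k $ l * G x $ a $ l) = (if k = a then 1 else 0)" for a
    using sum_inv_left[of k a] by (simp add: symmetric[of a])
  have "christoffel h k i j x = (1/2) * (\<Sum>l\<in>UNIV. matrix_inv (G x) $ k $ l *
      (pd i (\<lambda>y. G y $ j $ l) x + pd j (\<lambda>y. G y $ i $ l) x - pd l (\<lambda>y. G y $ i $ j) x)
      - 2 / u x * (pd i u x * (matrix_inv (G x) $ k $ l * G x $ j $ l) +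
         pd j u x * (matrix_inv (G x) $ k $ l * G x $ i $ l)
         - G x $ i $ j * (matrix_inv (G x) $ k $ l * pd l u x)))"
    unfolding christoffel_def h[of x] matrix_inv_scaleR[OF invertible, of "1 / (u x)\<^sup>2", simplified, OF u(2)] p
    using u(2) by (intro arg_cong[of _ _ "\<lambda>a. (1/2) * a"] sum.cong refl)
      (simp add: field_simps power2_eq_square power3_eq_cube)
  also have "\<dots> = christoffel G k i j x - (pd i u x * (\<Sum>l\<in>UNIV. matrix_inv (G x) $ k $ l * G x $ j $ l)
      + pd j u x * (\<Sum>l\<in>UNIV. matrix_inv (G x) $ k $ l * G x $ i $ l)
      - G x $ i $ j * (\<Sum>l\<in>UNIV. matrix_inv (G x) $ k $ l * pd l u x)) / u x"
    unfolding christoffel_def sum_subtractf sum.distrib sum_distrib_left[symmetric]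
    using u(2) by (simp add: field_simps)
  finally show ?thesis unfolding s by (simp add: gradient_def matrix_vector_mult_def)
qed

lemma metric_trace_conformal:
  assumes "h x = (1 / c\<^sup>2) *\<^sub>R G x" "c \<noteq> 0"
  shows "metric_trace h x C = c\<^sup>2 *\<^sub>R metric_trace G x C"
  using matrix_inv_scaleR[OF invertible, of "1 / c\<^sup>2"] assms
  by (simp add: metric_trace_def scaleR_sum_right)

lemma sum_gradient:
  "(\<Sum>k\<in>UNIV. gradient G u x $ k *\<^sub>R Z k) = metric_trace G x (\<lambda>i j. pd i u x *\<^sub>R Z j)"
proof -
  have "metric_trace G x (\<lambda>i j. pd i u x *\<^sub>R Z j) = metric_trace G x (\<lambda>i j. pd j u x *\<^sub>R Z i)"
    by (rule trace_swap[symmetric])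
  then show ?thesis
    by (simp add: metric_trace_def gradient_def matrix_vector_mult_def scaleR_sum_left)
qed

text \<open>The first-order term drops out in dimension two, where the Laplacian is conformally covariant.\<close>

lemma trace_conformal:
  fixes Z :: "'k \<Rightarrow> 'b::real_vector"
  assumes h: "\<And>y. h y = (1 / (u y)\<^sup>2) *\<^sub>R G y" and u: "u differentiable (at x)" "u x \<noteq> 0"
    and G: "\<And>i j. (\<lambda>y. G y $ i $ j) differentiable (at x)"
  shows "metric_trace h x (\<lambda>i j. B i j - (\<Sum>k\<in>UNIV. christoffel h k i j x *\<^sub>R Z k)) =
    (u x)\<^sup>2 *\<^sub>R metric_trace G x (\<lambda>i j. B i j - (\<Sum>k\<in>UNIV. christoffel G k i j x *\<^sub>R Z k))
    + ((2 - real CARD('k)) * u x) *\<^sub>R (\<Sum>k\<in>UNIV. gradient G u x $ k *\<^sub>R Z k)"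
proof -
  let ?g = "\<Sum>k\<in>UNIV. gradient G u x $ k *\<^sub>R Z k"
  have s: "(\<Sum>k\<in>UNIV. christoffel h k i j x *\<^sub>R Z k) = (\<Sum>k\<in>UNIV. christoffel G k i j x *\<^sub>R Z k)
     - (1 / u x) *\<^sub>R (pd i u x *\<^sub>R Z j + pd j u x *\<^sub>R Z i - G x $ i $ j *\<^sub>R ?g)" for i j
  proof -
    have "(\<Sum>k\<in>UNIV. christoffel h k i j x *\<^sub>R Z k) = (\<Sum>k\<in>UNIV. christoffel G k i j x *\<^sub>R Z k
      - (1 / u x) *\<^sub>R (pd i u x *\<^sub>R (if k = j then Z k else 0) + pd j u x *\<^sub>R (if k = i then Z k else 0)
        - G x $ i $ j *\<^sub>R (gradient G u x $ k *\<^sub>R Z k)))"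
      unfolding christoffel_conformal[OF assms]
      by (intro sum.cong refl) (simp add: scaleR_left_diff_distrib scaleR_left_distrib scaleR_right_diff_distrib
            scaleR_right_distrib add_divide_distrib diff_divide_distrib)
    then show ?thesis
      unfolding sum_subtractf sum.distrib scaleR_sum_right[symmetric] by simp
  qed
  \<comment> \<open>Each of the two symmetric terms contributes \<open>?g\<close> once; the metric
    term subtracts it \<open>CARD('k)\<close> times, which leaves the factor 2 minus the
    dimension.\<close>
  have t: "metric_trace G x (\<lambda>i j. pd i u x *\<^sub>R Z j) = ?g" "metric_trace G x (\<lambda>i j. pd j u x *\<^sub>R Z i) = ?g"
    unfolding sum_gradient by (rule refl, rule trace_swap)
  have "metric_trace h x (\<lambda>i j. B i j - (\<Sum>k\<in>UNIV. christoffel h k i j x *\<^sub>R Z k)) = (u x)\<^sup>2 *\<^sub>R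
     metric_trace G x (\<lambda>i j. (B i j - (\<Sum>k\<in>UNIV. christoffel G k i j x *\<^sub>R Z k)) +
       (1 / u x) *\<^sub>R (pd i u x *\<^sub>R Z j + pd j u x *\<^sub>R Z i - G x $ i $ j *\<^sub>R ?g))"
    unfolding metric_trace_conformal[of h "u x", OF h u(2)] s by (simp add: algebra_simps)
  also have "\<dots> = (u x)\<^sup>2 *\<^sub>R (metric_trace G x (\<lambda>i j. B i j - (\<Sum>k\<in>UNIV. christoffel G k i j x *\<^sub>R Z k)) +
       (1 / u x) *\<^sub>R (?g + ?g - real CARD('k) *\<^sub>R ?g))"
    unfolding metric_trace_add metric_trace_scaleR metric_trace_diff[of _ _ "\<lambda>i j. _ i j + _ i j"]
      metric_trace_scaleR_left t trace_metric ..
  also have "\<dots> = (u x)\<^sup>2 *\<^sub>R metric_trace G x (\<lambda>i j. B i j - (\<Sum>k\<in>UNIV. christoffel G k i j x *\<^sub>R Z k))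
    + ((2 - real CARD('k)) * u x) *\<^sub>R ?g"
    using u(2) by (simp add: scaleR_right_distrib power2_eq_square flip: scaleR_left_diff_distrib scaleR_2)
  finally show ?thesis .
qed

end

section \<open>Connection and curvature of the ambient conformal metric\<close>

definition flat_gradient :: "(real ^ 'n::finite \<Rightarrow> real) \<Rightarrow> real ^ 'n \<Rightarrow> real ^ 'n" where
  "flat_gradient f y = (\<chi> i. pd i f y)"

lemma inner_flat_gradient:
  assumes "f differentiable (at y)"
  shows "flat_gradient f y \<bullet> v = frechet_derivative f (at y) v"
  using frechet_derivative_eq_sum_pd[OF assms]
  by (simp add: flat_gradient_def inner_vec_def mult.commute)

lemma smooth_on_flat_gradient:
  fixes f :: "real ^ 'n::finite \<Rightarrow> real"
  assumes "open S" "smooth_on S f"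
  shows "smooth_on S (flat_gradient f)"
proof -
  have eq: "flat_gradient f = (\<lambda>y. \<Sum>i\<in>UNIV. pd i f y *\<^sub>R axis i 1)"
    by (simp add: fun_eq_iff vec_eq_iff flat_gradient_def axis_def if_distrib[of "\<lambda>a. _ * a"] cong: if_cong)
  show ?thesis unfolding eq
    by (intro smooth_on_sum smooth_on_scaleR smooth_on_pd smooth_on_const assms)
qed

lemma connection_term_conformal:
  fixes f :: "real ^ 'n::finite \<Rightarrow> real"
  assumes "f differentiable (at y)" "f y \<noteq> 0"
  shows "connection_term (conformal_metric f) y u v = - (1 / f y) *\<^sub>R
    ((flat_gradient f y \<bullet> u) *\<^sub>R v + (flat_gradient f y \<bullet> v) *\<^sub>R u - (u \<bullet> v) *\<^sub>R flat_gradient f y)"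
proof -
  interpret riemannian_point "flat_metric :: 'n metric" y
  proof
    show "invertible (flat_metric y :: real ^ 'n ^ 'n)"
      unfolding invertible_def flat_metric_def by (rule exI[of _ "mat 1"]) simp
  qed (simp add: flat_metric_def mat_def)
  have chf: "christoffel (flat_metric :: 'n metric) k i j y = 0" for k i j
    by (simp add: christoffel_def flat_metric_def)
  have inv: "matrix_inv (mat 1 :: real ^ 'n ^ 'n) = mat 1" by (rule matrix_inv_unique_right) simp
  have gr: "gradient flat_metric f y = flat_gradient f y"
    by (simp add: gradient_def flat_metric_def inv flat_gradient_def)
  have ch: "christoffel (conformal_metric f) k i j y = - (1 / f y) *
    (pd i f y * (if k = j then 1 else 0) + pd j f y * (if k = i then 1 else 0)
      - (if i = j then 1 else 0) * flat_gradient f y $ k)" for k i j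
    by (subst christoffel_conformal[OF _ assms])
      (auto simp: conformal_metric_def chf gr flat_metric_def mat_def field_simps)
  have "connection_term (conformal_metric f) y u v $ k = (- (1 / f y) *\<^sub>R
    ((flat_gradient f y \<bullet> u) *\<^sub>R v + (flat_gradient f y \<bullet> v) *\<^sub>R u - (u \<bullet> v) *\<^sub>R flat_gradient f y)) $ k" for k
  proof -
    have if_out: "(\<Sum>j\<in>UNIV. if P then a j else 0) = (if P then sum a UNIV else 0)"
      for P and a :: "'n \<Rightarrow> real" by simp
    have "connection_term (conformal_metric f) y u v $ k = - (1 / f y) *
        ((\<Sum>i\<in>UNIV. \<Sum>j\<in>UNIV. (pd i f y * u $ i) * (if k = j then v $ j else 0))
         + (\<Sum>i\<in>UNIV. \<Sum>j\<in>UNIV. (pd j f y * v $ j) * (if k = i then u $ i else 0))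
         - (\<Sum>i\<in>UNIV. \<Sum>j\<in>UNIV. (if i = j then u $ i * v $ j else 0) * flat_gradient f y $ k))"
      unfolding connection_term_def vec_lambda_beta ch sum_distrib_left sum.distrib[symmetric] sum_subtractf[symmetric]
      by (intro sum.cong refl) (auto simp: algebra_simps)
    also have "\<dots> = (- (1 / f y) *\<^sub>R
      ((flat_gradient f y \<bullet> u) *\<^sub>R v + (flat_gradient f y \<bullet> v) *\<^sub>R u - (u \<bullet> v) *\<^sub>R flat_gradient f y)) $ k"
      by (simp add: inner_vec_def flat_gradient_def sum_distrib_right sum_distrib_left if_out mult_ac
          if_distrib[of "\<lambda>a. _ * a"] cong: if_cong)
    finally show ?thesis .
  qed
  then show ?thesis by (simp add: vec_eq_iff)
qed

lemma inner_eqI: "(\<And>z. z \<bullet> a = z \<bullet> b) \<Longrightarrow> a = b"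
  using vector_eq_ldot by blast

text \<open>With \<open>S = - Hess f / f + |df|\<^sup>2 / (2 f\<^sup>2)\<close> the right-hand side is, up to sign, the Kulkarni-Nomizu product
  of the metric with the Schouten tensor.\<close>

lemma curvature_at_conformal:
  fixes f :: "real ^ 'n::finite \<Rightarrow> real"
  assumes f: "smooth_on UNIV f" "\<And>y. f y \<noteq> 0"
  defines "H \<equiv> \<lambda>y. frechet_derivative (flat_gradient f) (at y)"
  shows "curvature_at (conformal_metric f) y u v w =
     (1 / f y) *\<^sub>R ((H y v \<bullet> w) *\<^sub>R u - (H y u \<bullet> w) *\<^sub>R v + (v \<bullet> w) *\<^sub>R H y u - (u \<bullet> w) *\<^sub>R H y v)
     - ((flat_gradient f y \<bullet> flat_gradient f y) / (f y)\<^sup>2) *\<^sub>R ((v \<bullet> w) *\<^sub>R u - (u \<bullet> w) *\<^sub>R v)"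
proof -
  let ?d = "flat_gradient f"
  have df: "f differentiable (at y)" for y using f(1) smooth_on_differentiable by blast
  have dd: "(?d has_derivative H y) (at y)"
    unfolding H_def using smooth_on_differentiable[OF smooth_on_flat_gradient[OF open_UNIV f(1)]]
    by (simp add: frechet_derivative_works)
  have df': "(f has_derivative (\<lambda>v. ?d y \<bullet> v)) (at y)"
    using df[of y] by (simp add: inner_flat_gradient[OF df] frechet_derivative_works)
  \<comment> \<open>For constant fields the Lie bracket vanishes and the covariant derivative is the
    algebraic term \<open>C\<close>. The curvature thus consists of one derivative of
    \<open>C\<close> and one composition of two such terms, antisymmetrised.\<close>
  define C where "C v w z = - (1 / f z) *\<^sub>R ((?d z \<bullet> v) *\<^sub>R w + (?d z \<bullet> w) *\<^sub>R v - (v \<bullet> w) *\<^sub>R ?d z)" for v w z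
  have cC: "connection_term (conformal_metric f) z v w = C v w z" for z v w
    unfolding C_def by (rule connection_term_conformal[OF df f(2)])
  have cv: "covd (conformal_metric f) (\<lambda>_. v) (\<lambda>_. w) = C v w" for v w
    by (auto simp: covd_def cC)
  have dC: "frechet_derivative (C v w) (at y) u =
     - (1 / f y) *\<^sub>R ((H y u \<bullet> v) *\<^sub>R w + (H y u \<bullet> w) *\<^sub>R v - (v \<bullet> w) *\<^sub>R H y u)
       + ((?d y \<bullet> u) / (f y)\<^sup>2) *\<^sub>R ((?d y \<bullet> v) *\<^sub>R w + (?d y \<bullet> w) *\<^sub>R v - (v \<bullet> w) *\<^sub>R ?d y)" for u v w
  proof -
    have "((\<lambda>z. - (1 / f z)) has_derivative (\<lambda>u. (?d y \<bullet> u) / (f y)\<^sup>2)) (at y)"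
      using f(2)[of y] by (auto intro!: derivative_eq_intros df' simp: power2_eq_square field_simps)
    moreover have "((\<lambda>z. (?d z \<bullet> v) *\<^sub>R w + (?d z \<bullet> w) *\<^sub>R v - (v \<bullet> w) *\<^sub>R ?d z) has_derivative
        (\<lambda>u. (H y u \<bullet> v) *\<^sub>R w + (H y u \<bullet> w) *\<^sub>R v - (v \<bullet> w) *\<^sub>R H y u)) (at y)"
      by (intro has_derivative_diff has_derivative_add has_derivative_scaleR_left has_derivative_scaleR_right
          has_derivative_inner_left dd)
    ultimately have "(C v w has_derivative (\<lambda>u.
       - (1 / f y) *\<^sub>R ((H y u \<bullet> v) *\<^sub>R w + (H y u \<bullet> w) *\<^sub>R v - (v \<bullet> w) *\<^sub>R H y u)
       + ((?d y \<bullet> u) / (f y)\<^sup>2) *\<^sub>R ((?d y \<bullet> v) *\<^sub>R w + (?d y \<bullet> w) *\<^sub>R v - (v \<bullet> w) *\<^sub>R ?d y))) (at y)"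
      unfolding C_def[abs_def] by (rule has_derivative_scaleR)
    from fun_cong[OF frechet_derivative_at[OF this], of u] show ?thesis by (rule sym)
  qed
  have sym: "H y a \<bullet> b = H y b \<bullet> a" for a b
  proof -
    have "H y a \<bullet> b = frechet_derivative (\<lambda>z. frechet_derivative f (at z) b) (at y) a" for a b
    proof -
      have "((\<lambda>z. ?d z \<bullet> b) has_derivative (\<lambda>a. H y a \<bullet> b)) (at y)"
        by (intro has_derivative_inner_left dd)
      from fun_cong[OF frechet_derivative_at[OF this], of a] show ?thesis
        unfolding inner_flat_gradient[OF df] .
    qed
    then show ?thesis using dir_deriv_commute[OF open_UNIV f(1), of y a b] by simp
  qed
  have "curvature_at (conformal_metric f) y u v w =
      (frechet_derivative (C v w) (at y) u + C u (C v w y) y) - (frechet_derivative (C u w) (at y) v + C v (C u w y) y)"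
    unfolding curvature_at_def curvature_def cv by (simp add: covd_def lie_bracket_def cC C_def)
  also have "\<dots> = (1 / f y) *\<^sub>R ((H y v \<bullet> w) *\<^sub>R u - (H y u \<bullet> w) *\<^sub>R v + (v \<bullet> w) *\<^sub>R H y u - (u \<bullet> w) *\<^sub>R H y v)
     - ((?d y \<bullet> ?d y) / (f y)\<^sup>2) *\<^sub>R ((v \<bullet> w) *\<^sub>R u - (u \<bullet> w) *\<^sub>R v)"
  proof (rule inner_eqI)
    fix z
    \<comment> \<open>Tested against an arbitrary \<open>z\<close>, the claim is a polynomial
      identity in scalar products, with \<open>p\<close> an indeterminate. The facts
      \<open>c\<close> orient the symmetric products so that equal ones become equal atoms.\<close>
    define p where "p = 1 / f y"
    have p2: "a / (f y)\<^sup>2 = a * p\<^sup>2" for a by (simp add: p_def power_divide)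
    note c = inner_commute[of v u] sym[of v u] inner_commute[of u "?d y"] inner_commute[of v "?d y"]
    show "z \<bullet> ((frechet_derivative (C v w) (at y) u + C u (C v w y) y) -
        (frechet_derivative (C u w) (at y) v + C v (C u w y) y)) =
      z \<bullet> ((1 / f y) *\<^sub>R ((H y v \<bullet> w) *\<^sub>R u - (H y u \<bullet> w) *\<^sub>R v + (v \<bullet> w) *\<^sub>R H y u - (u \<bullet> w) *\<^sub>R H y v)
     - ((?d y \<bullet> ?d y) / (f y)\<^sup>2) *\<^sub>R ((v \<bullet> w) *\<^sub>R u - (u \<bullet> w) *\<^sub>R v))"
      unfolding dC unfolding C_def p2 p_def[symmetric] inner_add_right inner_diff_right inner_scaleR_right
        inner_minus_right inner_minus_left scaleR_minus_left c by algebra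
  qed
  finally show ?thesis .
qed

lemma euclidean_hessian_eq:
  fixes f :: "real ^ 'n::finite \<Rightarrow> real"
  assumes f: "smooth_on UNIV f"
  shows "euclidean_hessian f y u v = frechet_derivative (flat_gradient f) (at y) u \<bullet> v"
proof -
  have df: "f differentiable (at y)" for y using f smooth_on_differentiable by blast
  have "(flat_gradient f has_derivative frechet_derivative (flat_gradient f) (at y)) (at y)"
    using smooth_on_differentiable[OF smooth_on_flat_gradient[OF open_UNIV f]]
    by (simp add: frechet_derivative_works)
  from fun_cong[OF frechet_derivative_at[OF has_derivative_inner_left[OF this]], of u]
  show ?thesis unfolding euclidean_hessian_def inner_flat_gradient[OF df] by (rule sym)
qed

section \<open>Hypersurface patches in Euclidean space\<close>

text \<open>The divergence of a one-form with components \<open>P j\<close> and values in a fixed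
  vector space: only the connection of the domain enters. For \<open>P j = pd j V\<close> it is the
  componentwise Laplacian of \<open>V\<close>.\<close>

definition divergence :: "'k::finite metric \<Rightarrow> ('k \<Rightarrow> real ^ 'k \<Rightarrow> 'b::real_normed_vector) \<Rightarrow> real ^ 'k \<Rightarrow> 'b" where
  "divergence G P x = metric_trace G x (\<lambda>i j. pd i (P j) x - (\<Sum>k\<in>UNIV. christoffel G k i j x *\<^sub>R P k x))"

lemma laplacian_eq_divergence: "laplacian G u = divergence G (\<lambda>j. pd j u)"
  by (simp add: fun_eq_iff laplacian_def divergence_def hessian_def)

lemma divergence_add:
  assumes "\<And>j. P j differentiable (at x)" "\<And>j. Q j differentiable (at x)"
  shows "divergence G (\<lambda>j y. P j y + Q j y) x = divergence G P x + divergence G Q x"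
  unfolding divergence_def metric_trace_add[symmetric]
  by (simp add: pd_add[OF assms] scaleR_add_right sum.distrib add_diff_add)

lemma divergence_diff:
  assumes "\<And>j. P j differentiable (at x)" "\<And>j. Q j differentiable (at x)"
  shows "divergence G (\<lambda>j y. P j y - Q j y) x = divergence G P x - divergence G Q x"
  unfolding divergence_def metric_trace_diff[symmetric]
  by (simp add: pd_diff[OF assms] scaleR_diff_right sum_subtractf algebra_simps)

text \<open>The two product rules differ in the factor that carries the index of the one-form: here
  the vector, in \<open>divergence_scaleR_const_vector\<close> the scalar.\<close>

lemma divergence_scaleR:
  assumes "a differentiable (at x)" "\<And>j. Q j differentiable (at x)"
  shows "divergence G (\<lambda>j y. a y *\<^sub>R Q j y) x =
    metric_trace G x (\<lambda>i j. pd i a x *\<^sub>R Q j x) + a x *\<^sub>R divergence G Q x"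
proof -
  have "(\<Sum>k\<in>UNIV. christoffel G k i j x *\<^sub>R a x *\<^sub>R Q k x) =
      a x *\<^sub>R (\<Sum>k\<in>UNIV. christoffel G k i j x *\<^sub>R Q k x)" for i j
    by (simp add: scaleR_sum_right mult.commute)
  then show ?thesis
    unfolding divergence_def metric_trace_scaleR[symmetric] metric_trace_add[symmetric]
    by (simp add: pd_scaleR[OF assms] scaleR_diff_right algebra_simps)
qed

lemma divergence_scaleR_const_vector:
  assumes "\<And>j. b j differentiable (at x)" "W differentiable (at x)"
  shows "divergence G (\<lambda>j y. b j y *\<^sub>R W y) x =
    metric_trace G x (\<lambda>i j. b j x *\<^sub>R pd i W x) + divergence G b x *\<^sub>R W x"
proof -
  have "(\<Sum>k\<in>UNIV. christoffel G k i j x *\<^sub>R b k x *\<^sub>R W x) =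
      (\<Sum>k\<in>UNIV. christoffel G k i j x *\<^sub>R b k x) *\<^sub>R W x" for i j
    by (simp add: scaleR_sum_left)
  then show ?thesis
    unfolding divergence_def metric_trace_scaleR_left[symmetric] metric_trace_add[symmetric]
    by (simp add: pd_scaleR[OF assms] scaleR_left_diff_distrib algebra_simps)
qed

lemma differentiable_prod:
  fixes a :: "'i \<Rightarrow> 'a::real_normed_vector \<Rightarrow> 'b::real_normed_field"
  assumes "\<And>i. i \<in> I \<Longrightarrow> a i differentiable (at x)"
  shows "(\<lambda>y. \<Prod>i\<in>I. a i y) differentiable (at x)"
  by (rule differentiableI, rule has_derivative_prod[where f' = "\<lambda>i. frechet_derivative (a i) (at x)"])
    (simp add: assms flip: frechet_derivative_works)

lemma differentiable_det:
  fixes M :: "'a::real_normed_vector \<Rightarrow> real ^ 'k ^ 'k::finite"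
  assumes "\<And>i j. (\<lambda>y. M y $ i $ j) differentiable (at x)"
  shows "(\<lambda>y. det (M y)) differentiable (at x)"
  unfolding det_def
  by (intro differentiable_sum differentiable_mult differentiable_const differentiable_prod assms ballI) auto

text \<open>By Cramer's rule each entry of the inverse is a quotient of determinants, and these are
  polynomials in the entries. It serves to differentiate the dual frame of a hypersurface.\<close>

lemma differentiable_matrix_inv:
  fixes M :: "'a::real_normed_vector \<Rightarrow> real ^ 'k ^ 'k::finite"
  assumes M: "\<And>i j. (\<lambda>y. M y $ i $ j) differentiable (at x)"
    and S: "open S" "x \<in> S" "\<And>y. y \<in> S \<Longrightarrow> invertible (M y)"
  shows "(\<lambda>y. matrix_inv (M y) $ i $ j) differentiable (at x)"
proof -
  define N where "N y = (\<chi> a b. if b = i then axis j 1 $ a else M y $ a $ b)" for y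
  have "(\<lambda>y. N y $ a $ b) differentiable (at x)" for a b
    by (cases "b = i") (simp_all add: N_def M)
  then have "(\<lambda>y. det (N y) / det (M y)) differentiable (at x)"
    using S(3)[OF S(2)] M invertible_det_nz[of "M x"] by (intro differentiable_divide differentiable_det) auto
  moreover have "det (N y) / det (M y) = matrix_inv (M y) $ i $ j" if "y \<in> S" for y
  proof -
    have "M y *v (matrix_inv (M y) *v axis j 1) = axis j 1"
      by (simp add: matrix_vector_mul_assoc matrix_inv_inverse S that)
    then have "matrix_inv (M y) *v axis j 1 = (\<chi> k. det (\<chi> a b. if b = k then axis j 1 $ a else M y $ a $ b) / det (M y))"
      using cramer[of "M y"] S that invertible_det_nz by blast
    then have "(matrix_inv (M y) *v axis j 1) $ i = det (N y) / det (M y)"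
      by (simp add: N_def)
    then show ?thesis
      by (simp add: matrix_vector_mult_basis column_def)
  qed
  ultimately show ?thesis
    using S(1,2) unfolding differentiable_def by (blast intro: has_derivative_transform_within_open)
qed

section \<open>Hypersurfaces with a unit normal\<close>

locale hypersurface_patch =
  fixes U :: "(real ^ 'm::finite) set" and F \<xi> :: "real ^ 'm \<Rightarrow> real ^ 'n::finite"
  assumes open_U: "open U" and smooth_F: "smooth_on U F" and smooth_xi: "smooth_on U \<xi>"
    and inj: "\<And>x. x \<in> U \<Longrightarrow> inj (frechet_derivative F (at x))"
    and unit: "\<And>x. x \<in> U \<Longrightarrow> norm (\<xi> x) = 1"
    and normal: "\<And>x v. x \<in> U \<Longrightarrow> frechet_derivative F (at x) v \<bullet> \<xi> x = 0"
    and dim: "CARD('n) = CARD('m) + 1"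
begin

definition g :: "'m metric" where "g y = (\<chi> i j. pd i F y \<bullet> pd j F y)"

text \<open>The body of \<open>shape_operator\<close> with the local representatives as parameters,
  so that the two agree by unfolding. \<open>L_A\<close> shows that the description denotes.\<close>

definition A :: "real ^ 'm \<Rightarrow> real ^ 'm \<Rightarrow> real ^ 'm" where
  "A y v = (THE w. frechet_derivative F (at y) w = - frechet_derivative \<xi> (at y) v)"

abbreviation L :: "real ^ 'm \<Rightarrow> real ^ 'm \<Rightarrow> real ^ 'n" where
  "L x \<equiv> frechet_derivative F (at x)"

lemma differentiable_F [simp]: "x \<in> U \<Longrightarrow> F differentiable (at x)"
  by (rule smooth_on_differentiable[OF smooth_F])
lemma differentiable_xi [simp]: "x \<in> U \<Longrightarrow> \<xi> differentiable (at x)"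
  by (rule smooth_on_differentiable[OF smooth_xi])
lemma differentiable_pd_F [simp]: "x \<in> U \<Longrightarrow> pd i F differentiable (at x)"
  by (rule smooth_on_differentiable[OF smooth_on_pd[OF smooth_F]])
lemma differentiable_pd_xi [simp]: "x \<in> U \<Longrightarrow> pd i \<xi> differentiable (at x)"
  by (rule smooth_on_differentiable[OF smooth_on_pd[OF smooth_xi]])

lemma linear_L: "x \<in> U \<Longrightarrow> linear (L x)"
  by (simp add: linear_frechet_derivative)

lemma L_axis [simp]: "L x (axis i 1) = pd i F x"
  by (simp add: pd_def)

lemma pd_commute_F: "x \<in> U \<Longrightarrow> pd i (pd j F) x = pd j (pd i F) x"
  unfolding pd_def[abs_def] by (rule dir_deriv_commute[OF open_U smooth_F])
lemma pd_commute_xi: "x \<in> U \<Longrightarrow> pd i (pd j \<xi>) x = pd j (pd i \<xi>) x"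
  unfolding pd_def[abs_def] by (rule dir_deriv_commute[OF open_U smooth_xi])

lemma xi_xi [simp]: "x \<in> U \<Longrightarrow> \<xi> x \<bullet> \<xi> x = 1"
  using unit[of x] by (simp add: norm_eq_1)
lemma normal_pd [simp]: "x \<in> U \<Longrightarrow> pd i F x \<bullet> \<xi> x = 0" "x \<in> U \<Longrightarrow> \<xi> x \<bullet> pd i F x = 0"
  using normal[of x "axis i 1"] by (simp_all add: inner_commute)
lemma normal_xi [simp]: "x \<in> U \<Longrightarrow> \<xi> x \<bullet> L x v = 0"
  using normal[of x v] by (simp add: inner_commute)

text \<open>The Leibniz rule for a constant scalar product. Applied to \<open>\<xi>\<close> with
  itself, to \<open>\<xi>\<close> with tangent vectors and to the dual frame, it moves a derivative
  from one factor to the other.\<close>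

lemma dir_deriv_inner_const:
  assumes "x \<in> U" "V differentiable (at x)" "W differentiable (at x)" "\<And>y. y \<in> U \<Longrightarrow> V y \<bullet> W y = c"
  shows "frechet_derivative V (at x) v \<bullet> W x = - (V x \<bullet> frechet_derivative W (at x) v)"
proof -
  have d: "((\<lambda>y. V y \<bullet> W y) has_derivative (\<lambda>v. V x \<bullet> frechet_derivative W (at x) v
      + frechet_derivative V (at x) v \<bullet> W x)) (at x)"
    using assms by (intro has_derivative_inner) (auto simp: frechet_derivative_works)
  have "((\<lambda>y. c) has_derivative (\<lambda>v. V x \<bullet> frechet_derivative W (at x) v
      + frechet_derivative V (at x) v \<bullet> W x)) (at x)"
    by (rule has_derivative_transform_within_open[OF d open_U assms(1,4)])
  from fun_cong[OF frechet_derivative_at[OF this], of v] show ?thesis by simp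
qed

lemma dxi_xi [simp]:
  assumes "x \<in> U"
  shows "frechet_derivative \<xi> (at x) v \<bullet> \<xi> x = 0" "\<xi> x \<bullet> frechet_derivative \<xi> (at x) v = 0"
  using dir_deriv_inner_const[of x \<xi> \<xi> 1 v] assms by (simp_all add: inner_commute)

lemma pd_xi_xi [simp]: "x \<in> U \<Longrightarrow> pd i \<xi> x \<bullet> \<xi> x = 0" "x \<in> U \<Longrightarrow> \<xi> x \<bullet> pd i \<xi> x = 0"
  by (simp_all add: pd_def)

text \<open>Differentiating the orthogonality of \<open>\<xi>\<close> to tangent vectors expresses
  both sides through second derivatives of \<open>F\<close>, which commute.\<close>

lemma second_form_symmetric:
  assumes "x \<in> U"
  shows "frechet_derivative \<xi> (at x) v \<bullet> L x w = frechet_derivative \<xi> (at x) w \<bullet> L x v"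
proof -
  have sec: "dir_deriv a (dir_deriv b F) x \<bullet> \<xi> x = - (L x b \<bullet> frechet_derivative \<xi> (at x) a)" for a b
    by (rule dir_deriv_inner_const[OF assms])
      (use assms normal in \<open>auto intro: smooth_on_differentiable[OF smooth_on_frechet_derivative[OF smooth_F]]\<close>)
  have "L x w \<bullet> frechet_derivative \<xi> (at x) v = L x v \<bullet> frechet_derivative \<xi> (at x) w"
    using sec[of v w] sec[of w v] dir_deriv_commute[OF open_U smooth_F assms, of v w] by simp
  then show ?thesis by (simp add: inner_commute)
qed

lemma pd_second_form_symmetric: "x \<in> U \<Longrightarrow> pd i \<xi> x \<bullet> pd j F x = pd j \<xi> x \<bullet> pd i F x"
  unfolding pd_def by (rule second_form_symmetric)

text \<open>A dimension count: the image of the differential lies in the hyperplane orthogonal to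
  \<open>\<xi>\<close>, and injectivity and codimension one make the dimensions equal.\<close>

lemma tangent_iff:
  assumes "x \<in> U"
  shows "v \<bullet> \<xi> x = 0 \<longleftrightarrow> v \<in> range (L x)"
proof -
  have "range (L x) = {v. \<xi> x \<bullet> v = 0}"
  proof (rule subspace_dim_equal)
    show "subspace (range (L x))" using linear_L[OF assms] by (simp add: linear_subspace_image)
    show "subspace {v. \<xi> x \<bullet> v = 0}" by (rule subspace_hyperplane)
    show "range (L x) \<subseteq> {v. \<xi> x \<bullet> v = 0}" using assms by auto
    have "\<xi> x \<noteq> 0" using unit[OF assms] by auto
    then have "dim {v. \<xi> x \<bullet> v = 0} = CARD('n) - 1"
      by (simp add: dim_hyperplane)
    moreover have "dim (range (L x)) = CARD('m)"
      using dim_image_eq[OF linear_L[OF assms], of UNIV] inj[OF assms] by simp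
    ultimately show "dim {v. \<xi> x \<bullet> v = 0} \<le> dim (range (L x))"
      using dim by simp
  qed
  then show ?thesis by (auto simp: inner_commute)
qed

lemma L_A: assumes "x \<in> U" shows "L x (A x v) = - frechet_derivative \<xi> (at x) v"
proof -
  have "- frechet_derivative \<xi> (at x) v \<in> range (L x)"
    using tangent_iff[OF assms, of "- frechet_derivative \<xi> (at x) v"] assms by simp
  then have "\<exists>!w. L x w = - frechet_derivative \<xi> (at x) v"
    using inj[OF assms] by (auto simp: inj_def)
  from theI'[OF this] show ?thesis unfolding A_def .
qed

lemma pd_xi: "x \<in> U \<Longrightarrow> pd i \<xi> x = - L x (A x (axis i 1))"
  by (simp add: L_A pd_def)

lemma A_self_adjoint: "x \<in> U \<Longrightarrow> L x (A x v) \<bullet> L x w = L x v \<bullet> L x (A x w)"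
  using second_form_symmetric[of x v w] by (simp add: L_A inner_commute)

text \<open>The vectors \<open>pd k F x\<close> and \<open>\<xi> x\<close> together span the ambient
  space.\<close>

lemma tangent_normal_eqI:
  assumes x: "x \<in> U" and "v \<bullet> \<xi> x = w \<bullet> \<xi> x" "\<And>k. v \<bullet> pd k F x = w \<bullet> pd k F x"
  shows "v = w"
proof -
  have "(v - w) \<bullet> \<xi> x = 0" using assms by (simp add: inner_diff_left)
  then obtain a where a: "v - w = L x a" using tangent_iff[OF x] by blast
  have "(v - w) \<bullet> (v - w) = (\<Sum>k\<in>UNIV. a $ k * ((v - w) \<bullet> pd k F x))"
    by (subst (2) a, subst frechet_derivative_eq_sum_pd) (simp_all add: x inner_sum_right)
  also have "\<dots> = 0" using assms(3) by (simp add: inner_diff_left)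
  finally show ?thesis by simp
qed

lemma g_mult: "x \<in> U \<Longrightarrow> (g x *v w) $ i = pd i F x \<bullet> L x w"
  by (subst frechet_derivative_eq_sum_pd) (simp_all add: g_def matrix_vector_mult_def inner_sum_right mult.commute)

lemma metric_inner_g: assumes "x \<in> U" shows "metric_inner g x v w = L x v \<bullet> L x w"
proof -
  have "metric_inner g x v w = (\<Sum>i\<in>UNIV. v $ i *\<^sub>R pd i F x) \<bullet> L x w"
    unfolding metric_inner_def inner_vec_def[of v] by (simp add: g_mult assms inner_sum_left)
  then show ?thesis by (simp add: frechet_derivative_eq_sum_pd[OF differentiable_F[OF assms], of v])
qed

lemma riemannian_point_g: assumes x: "x \<in> U" shows "riemannian_point g x"
proof
  show "g x $ i $ j = g x $ j $ i" for i j by (simp add: g_def inner_commute)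
  have "w = 0" if "g x *v w = 0" for w
  proof -
    have "L x w \<bullet> L x w = 0" using metric_inner_g[OF x, of w w] that by (simp add: metric_inner_def)
    then have "L x w = L x 0" using linear_0[OF linear_L[OF x]] by simp
    then show ?thesis using inj[OF x] by (simp add: inj_eq)
  qed
  then have "\<exists>B. B ** g x = mat 1" using matrix_left_invertible_ker by blast
  then show "invertible (g x)" using invertible_left_inverse by blast
qed

lemma differentiable_g: "x \<in> U \<Longrightarrow> (\<lambda>y. g y $ i $ j) differentiable (at x)"
  by (simp add: g_def)

lemma pd_g: "x \<in> U \<Longrightarrow> pd k (\<lambda>y. g y $ i $ j) x = pd i F x \<bullet> pd k (pd j F) x + pd k (pd i F) x \<bullet> pd j F x"
  by (simp add: g_def pd_inner)

lemma sum_inv_g: "x \<in> U \<Longrightarrow> (\<Sum>i\<in>UNIV. matrix_inv (g x) $ j $ i * (pd i F x \<bullet> L x w)) = w $ j"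
  using arg_cong[OF matrix_inv_inverse(2)[OF riemannian_point.invertible[OF riemannian_point_g]], of x "\<lambda>M. (M *v w) $ j"]
  by (simp flip: matrix_vector_mul_assoc g_mult) (simp add: matrix_vector_mult_def)

lemma L_gradient: "x \<in> U \<Longrightarrow> L x (gradient g u x) \<bullet> pd k F x = pd k u x"
proof -
  assume x: "x \<in> U"
  have "g x *v gradient g u x = (\<chi> i. pd i u x)"
    using matrix_inv_inverse(1)[OF riemannian_point.invertible[OF riemannian_point_g[OF x]]]
    by (simp add: gradient_def matrix_vector_mul_assoc)
  then show ?thesis using g_mult[OF x, of "gradient g u x" k] by (simp add: inner_commute)
qed

text \<open>Turns metric traces of bilinear forms into traces of matrices, the form in which
  minimality and the norm of the shape operator are stated.\<close>

lemma trace_endomorphism: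
  assumes x: "x \<in> U"
  shows "metric_trace g x (\<lambda>i j. pd i F x \<bullet> L x (K (axis j 1))) = trace (matrix K)"
proof -
  have "metric_trace g x (\<lambda>i j. pd i F x \<bullet> L x (K (axis j 1))) =
      metric_trace g x (\<lambda>i j. pd j F x \<bullet> L x (K (axis i 1)))"
    by (rule riemannian_point.trace_swap[OF riemannian_point_g[OF x], symmetric])
  also have "\<dots> = trace (matrix K)"
    by (simp add: metric_trace_def sum_inv_g[OF x] trace_def matrix_def)
  finally show ?thesis .
qed

lemma trace_second_form:
  assumes x: "x \<in> U"
  shows "metric_trace g x (\<lambda>i j. pd i F x \<bullet> pd j \<xi> x) = - trace (matrix (A x))"
proof -
  have "metric_trace g x (\<lambda>i j. pd i F x \<bullet> pd j \<xi> x) =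
      metric_trace g x (\<lambda>i j. (- 1) * (pd i F x \<bullet> L x (A x (axis j 1))))"
    by (simp add: pd_xi x)
  then show ?thesis unfolding metric_trace_mult trace_endomorphism[OF x] by simp
qed

lemma trace_third_form:
  assumes x: "x \<in> U"
  shows "metric_trace g x (\<lambda>i j. pd i \<xi> x \<bullet> pd j \<xi> x) = trace (matrix (A x \<circ> A x))"
proof -
  have "metric_trace g x (\<lambda>i j. pd i \<xi> x \<bullet> pd j \<xi> x) =
      metric_trace g x (\<lambda>i j. pd i F x \<bullet> L x ((A x \<circ> A x) (axis j 1)))"
    using A_self_adjoint[OF x, of "axis _ 1" "A x (axis _ 1)"] by (simp add: pd_xi x)
  then show ?thesis unfolding trace_endomorphism[OF x] .
qed

text \<open>Koszul's formula in coordinates: the Christoffel symbols give the tangential part of the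
  second derivatives of \<open>F\<close>. What remains after subtracting it is therefore
  normal.\<close>

lemma christoffel_lower:
  assumes x: "x \<in> U"
  shows "(\<Sum>l\<in>UNIV. christoffel g l i j x *\<^sub>R pd l F x) \<bullet> pd k F x = pd i (pd j F) x \<bullet> pd k F x"
proof -
  interpret riemannian_point g x by (rule riemannian_point_g[OF x])
  define c where "c a = pd i (\<lambda>y. g y $ j $ a) x + pd j (\<lambda>y. g y $ i $ a) x - pd a (\<lambda>y. g y $ i $ j) x" for a
  \<comment> \<open>Differentiating the three Gram entries gives six terms, of which four cancel by
    symmetry of second derivatives.\<close>
  have c: "c a = 2 * (pd i (pd j F) x \<bullet> pd a F x)" for a
    unfolding c_def pd_g[OF x]
    by (simp add: pd_commute_F[OF x, of j i] pd_commute_F[OF x, of _ a] inner_commute)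
  have "(\<Sum>l\<in>UNIV. christoffel g l i j x *\<^sub>R pd l F x) \<bullet> pd k F x =
      (\<Sum>l\<in>UNIV. \<Sum>a\<in>UNIV. (1/2) * c a * (matrix_inv (g x) $ l $ a * g x $ l $ k))"
    unfolding christoffel_def c_def[symmetric]
    by (simp add: inner_sum_left g_def sum_distrib_left sum_distrib_right sum_divide_distrib mult_ac)
  also have "\<dots> = (\<Sum>a\<in>UNIV. \<Sum>l\<in>UNIV. (1/2) * c a * (matrix_inv (g x) $ a $ l * g x $ l $ k))"
    by (subst sum.swap) (simp add: inv_symmetric)
  also have "\<dots> = (1/2) * c k"
    unfolding sum_distrib_left[symmetric] sum_inv_left by (simp add: if_distrib cong: if_cong)
  finally show ?thesis by (simp add: c)
qed

lemma pd_pd_F_xi: "x \<in> U \<Longrightarrow> pd i (pd j F) x \<bullet> \<xi> x = - (pd j F x \<bullet> pd i \<xi> x)"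
  unfolding pd_def[of i] by (rule dir_deriv_inner_const) auto

lemma pd_pd_xi_xi: "x \<in> U \<Longrightarrow> pd i (pd j \<xi>) x \<bullet> \<xi> x = - (pd i \<xi> x \<bullet> pd j \<xi> x)"
  unfolding pd_def[of i] by (subst dir_deriv_inner_const[of _ _ _ 0]) (auto simp: inner_commute)

text \<open>The tangent frame dual to \<open>pd j F\<close>. A metric trace becomes a single sum
  against it (\<open>trace_eq_dual\<close>), and its derivative is governed by the constancy of the
  pairings in \<open>dual_pd\<close>.\<close>

definition dual :: "'m \<Rightarrow> real ^ 'm \<Rightarrow> real ^ 'n" where
  "dual i y = (\<Sum>j\<in>UNIV. matrix_inv (g y) $ i $ j *\<^sub>R pd j F y)"

lemma dual_L: "x \<in> U \<Longrightarrow> dual i x \<bullet> L x w = w $ i"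
  using sum_inv_g[of x i w] by (simp add: dual_def inner_sum_left)

lemma dual_pd: "x \<in> U \<Longrightarrow> dual i x \<bullet> pd j F x = (if i = j then 1 else 0)"
  using dual_L[of x i "axis j 1"] unfolding L_axis by (auto simp: axis_def)

lemma dual_xi: "x \<in> U \<Longrightarrow> dual i x \<bullet> \<xi> x = 0"
  by (simp add: dual_def inner_sum_left)

lemma differentiable_dual: "x \<in> U \<Longrightarrow> dual i differentiable (at x)"
  unfolding dual_def[abs_def]
  by (intro differentiable_sum differentiable_scaleR ballI differentiable_matrix_inv[OF differentiable_g open_U])
    (auto intro: riemannian_point.invertible[OF riemannian_point_g])

lemma trace_eq_dual: "metric_trace g x (\<lambda>i j. pd i F x \<bullet> V j) = (\<Sum>j\<in>UNIV. dual j x \<bullet> V j)" if "x \<in> U"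
proof -
  interpret riemannian_point g x by (rule riemannian_point_g[OF that])
  have "metric_trace g x (\<lambda>i j. pd i F x \<bullet> V j) = metric_trace g x (\<lambda>i j. pd j F x \<bullet> V i)"
    by (rule trace_swap[symmetric])
  then show ?thesis by (simp add: metric_trace_def dual_def inner_sum_left)
qed

end

section \<open>Laplacians on a minimal hypersurface\<close>

locale minimal_patch = hypersurface_patch U F \<xi>
  for U :: "(real ^ 'm::finite) set" and F \<xi> :: "real ^ 'm \<Rightarrow> real ^ 'n::finite" +
  assumes minimal: "\<And>x. x \<in> U \<Longrightarrow> trace (matrix (A x)) = 0"
begin

lemma trace_second_form_0: "x \<in> U \<Longrightarrow> metric_trace g x (\<lambda>i j. pd i F x \<bullet> pd j \<xi> x) = 0"
  by (simp add: trace_second_form minimal)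

text \<open>The tangential part vanishes for every immersion by \<open>christoffel_lower\<close>;
  the normal part is the trace of the shape operator.\<close>

lemma laplacian_F: assumes x: "x \<in> U" shows "divergence g (\<lambda>j. pd j F) x = 0"
proof (rule tangent_normal_eqI[OF x])
  have "divergence g (\<lambda>j. pd j F) x \<bullet> \<xi> x = metric_trace g x (\<lambda>i j. (- 1) * (pd j F x \<bullet> pd i \<xi> x))"
    unfolding divergence_def metric_trace_inner_left[symmetric]
    by (simp add: inner_diff_left inner_sum_left pd_pd_F_xi x)
  also have "\<dots> = - metric_trace g x (\<lambda>i j. pd i F x \<bullet> pd j \<xi> x)"
    unfolding metric_trace_mult riemannian_point.trace_swap[OF riemannian_point_g[OF x], of "\<lambda>i j. pd i F x \<bullet> pd j \<xi> x"]
    by simp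
  finally show "divergence g (\<lambda>j. pd j F) x \<bullet> \<xi> x = 0 \<bullet> \<xi> x" by (simp add: trace_second_form_0 x)
  show "divergence g (\<lambda>j. pd j F) x \<bullet> pd k F x = 0 \<bullet> pd k F x" for k
    unfolding divergence_def metric_trace_inner_left[symmetric] inner_diff_left christoffel_lower[OF x]
    by (simp add: metric_trace_def)
qed

text \<open>The derivative of the identity \<open>tr A = 0\<close>.  The dual frame absorbs the derivative of the
  inverse Gram matrix.\<close>

lemma pd_trace_second_form:
  assumes x: "x \<in> U"
  shows "metric_trace g x (\<lambda>i j. pd i F x \<bullet> pd k (pd j \<xi>) x) = metric_trace g x (\<lambda>i j. pd k (pd i F) x \<bullet> pd j \<xi> x)"
proof -
  interpret riemannian_point g x by (rule riemannian_point_g[OF x])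
  have sum0: "(\<Sum>j\<in>UNIV. dual j y \<bullet> pd j \<xi> y) = 0" if "y \<in> U" for y
    using trace_second_form_0[OF that] unfolding trace_eq_dual[OF that] .
  have diff: "(\<lambda>y. dual j y \<bullet> pd j \<xi> y) differentiable (at x)" for j
    using x by (intro differentiable_inner differentiable_dual) auto
  have "pd k (\<lambda>y. \<Sum>j\<in>UNIV. dual j y \<bullet> pd j \<xi> y) x = pd k (\<lambda>y. 0) x"
    by (rule pd_cong[OF _ open_U x]) (use diff sum0 in auto)
  then have "(\<Sum>j\<in>UNIV. dual j x \<bullet> pd k (pd j \<xi>) x + pd k (dual j) x \<bullet> pd j \<xi> x) = 0"
    by (simp add: pd_sum[OF diff] pd_inner[OF differentiable_dual[OF x] differentiable_pd_xi[OF x]])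
  then have 1: "metric_trace g x (\<lambda>i j. pd i F x \<bullet> pd k (pd j \<xi>) x) = - (\<Sum>j\<in>UNIV. pd k (dual j) x \<bullet> pd j \<xi> x)"
    unfolding trace_eq_dual[OF x] by (simp add: sum.distrib)
  have dd: "pd k (dual j) x \<bullet> pd l F x = - (dual j x \<bullet> pd k (pd l F) x)" for j l
    unfolding pd_def[of k]
    by (rule dir_deriv_inner_const[OF x differentiable_dual[OF x] differentiable_pd_F[OF x] dual_pd])
  \<comment> \<open>The derivative of the dual frame is accessible through its products with the
    \<open>pd l F x\<close>, by \<open>dd\<close>; as \<open>pd j \<xi> x\<close> is tangent, it can
    be expanded in that frame.\<close>
  have t: "pd j \<xi> x = (\<Sum>l\<in>UNIV. (dual l x \<bullet> pd j \<xi> x) *\<^sub>R pd l F x)" for j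
  proof -
    have w: "pd j \<xi> x = L x (- A x (axis j 1))"
      by (simp add: pd_xi x linear_neg[OF linear_L[OF x]])
    show ?thesis
      unfolding w dual_L[OF x] by (rule frechet_derivative_eq_sum_pd[OF differentiable_F[OF x]])
  qed
  \<comment> \<open>Symmetry of the second fundamental form: both sides have the product
    \<open>dual l x \<bullet> pd a \<xi> x\<close> with \<open>pd a F x\<close>. This exchanges the
    dual frame for the inverse Gram matrix again.\<close>
  have s: "(\<Sum>j\<in>UNIV. (dual l x \<bullet> pd j \<xi> x) *\<^sub>R dual j x) = (\<Sum>j\<in>UNIV. matrix_inv (g x) $ l $ j *\<^sub>R pd j \<xi> x)" for l
  proof (rule tangent_normal_eqI[OF x])
    fix a
    have "(\<Sum>j\<in>UNIV. matrix_inv (g x) $ l $ j *\<^sub>R pd j \<xi> x) \<bullet> pd a F x = dual l x \<bullet> pd a \<xi> x"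
      by (simp add: dual_def inner_sum_left pd_second_form_symmetric[OF x, of _ a]) (simp add: inner_commute)
    then show "(\<Sum>j\<in>UNIV. (dual l x \<bullet> pd j \<xi> x) *\<^sub>R dual j x) \<bullet> pd a F x =
        (\<Sum>j\<in>UNIV. matrix_inv (g x) $ l $ j *\<^sub>R pd j \<xi> x) \<bullet> pd a F x"
      by (simp add: inner_sum_left dual_pd x if_distrib cong: if_cong)
  qed (simp add: inner_sum_left dual_xi x)
  have "(\<Sum>j\<in>UNIV. pd k (dual j) x \<bullet> pd j \<xi> x) =
      (\<Sum>j\<in>UNIV. \<Sum>l\<in>UNIV. (dual l x \<bullet> pd j \<xi> x) * (pd k (dual j) x \<bullet> pd l F x))"
    by (subst t) (simp add: inner_sum_right)
  also have "\<dots> = - (\<Sum>l\<in>UNIV. (\<Sum>j\<in>UNIV. (dual l x \<bullet> pd j \<xi> x) *\<^sub>R dual j x) \<bullet> pd k (pd l F) x)"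
    by (subst sum.swap) (simp add: dd inner_sum_left sum_negf)
  also have "\<dots> = - metric_trace g x (\<lambda>i j. pd k (pd i F) x \<bullet> pd j \<xi> x)"
    unfolding s by (simp add: metric_trace_def inner_sum_left) (simp add: inner_commute)
  finally show ?thesis using 1 by simp
qed

text \<open>The normal part is minus the trace of the third fundamental form. In the tangential part
  the Codazzi relation moves the free index \<open>k\<close> to the front, where the derivative of
  tr A = 0 applies.\<close>

lemma laplacian_xi:
  assumes x: "x \<in> U"
  shows "divergence g (\<lambda>j. pd j \<xi>) x = - trace (matrix (A x \<circ> A x)) *\<^sub>R \<xi> x"
proof (rule tangent_normal_eqI[OF x])
  interpret riemannian_point g x by (rule riemannian_point_g[OF x])
  have "divergence g (\<lambda>j. pd j \<xi>) x \<bullet> \<xi> x = metric_trace g x (\<lambda>i j. (- 1) * (pd i \<xi> x \<bullet> pd j \<xi> x))"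
    unfolding divergence_def metric_trace_inner_left[symmetric]
    by (simp add: inner_diff_left inner_sum_left pd_pd_xi_xi x)
  then show "divergence g (\<lambda>j. pd j \<xi>) x \<bullet> \<xi> x = (- trace (matrix (A x \<circ> A x)) *\<^sub>R \<xi> x) \<bullet> \<xi> x"
    unfolding metric_trace_mult by (simp add: trace_third_form x)
  fix k
  \<comment> \<open>Codazzi's relation in coordinates, from differentiating the symmetry of the
    second fundamental form and commuting partial derivatives.\<close>
  have 1: "pd i (pd j \<xi>) x \<bullet> pd k F x = pd i (pd j F) x \<bullet> pd k \<xi> x + pd j F x \<bullet> pd k (pd i \<xi>) x
      - pd k (pd i F) x \<bullet> pd j \<xi> x" for i j
  proof -
    have "pd i (\<lambda>y. pd j \<xi> y \<bullet> pd k F y) x = pd i (\<lambda>y. pd k \<xi> y \<bullet> pd j F y) x"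
      by (rule pd_cong[OF _ open_U x]) (use x pd_second_form_symmetric in auto)
    then show ?thesis
      by (simp add: pd_inner x inner_commute pd_commute_F[OF x, of i k] pd_commute_xi[OF x, of i k])
  qed
  \<comment> \<open>The Christoffel correction undergoes the same exchange, so it combines with the
    first term of \<open>1\<close> to the Laplacian of \<open>F\<close> paired with
    \<open>pd k \<xi> x\<close>.\<close>
  have 2: "(\<Sum>l\<in>UNIV. christoffel g l i j x *\<^sub>R pd l \<xi> x) \<bullet> pd k F x =
      (\<Sum>l\<in>UNIV. christoffel g l i j x *\<^sub>R pd l F x) \<bullet> pd k \<xi> x" for i j
    by (simp add: inner_sum_left pd_second_form_symmetric[OF x, of _ k]) (simp add: inner_commute)
  have "divergence g (\<lambda>j. pd j \<xi>) x \<bullet> pd k F x =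
      metric_trace g x (\<lambda>i j. (pd i (pd j F) x - (\<Sum>l\<in>UNIV. christoffel g l i j x *\<^sub>R pd l F x)) \<bullet> pd k \<xi> x
        + pd j F x \<bullet> pd k (pd i \<xi>) x - pd k (pd i F) x \<bullet> pd j \<xi> x)"
    unfolding divergence_def metric_trace_inner_left[symmetric] inner_diff_left 1 2 by (simp add: algebra_simps)
  also have "\<dots> = divergence g (\<lambda>j. pd j F) x \<bullet> pd k \<xi> x + metric_trace g x (\<lambda>i j. pd j F x \<bullet> pd k (pd i \<xi>) x)
      - metric_trace g x (\<lambda>i j. pd k (pd i F) x \<bullet> pd j \<xi> x)"
    unfolding metric_trace_diff metric_trace_add metric_trace_inner_left divergence_def ..
  also have "\<dots> = 0"
    using pd_trace_second_form[OF x, of k] trace_swap[of "\<lambda>i j. pd i F x \<bullet> pd k (pd j \<xi>) x"]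
    by (simp add: laplacian_F[OF x])
  finally show "divergence g (\<lambda>j. pd j \<xi>) x \<bullet> pd k F x = (- trace (matrix (A x \<circ> A x)) *\<^sub>R \<xi> x) \<bullet> pd k F x"
    using x by simp
qed

end

section \<open>The bitension field\<close>

locale conformal_patch = minimal_patch U F \<xi>
  for U :: "(real ^ 'm::finite) set" and F \<xi> :: "real ^ 'm \<Rightarrow> real ^ 'n::finite" +
  fixes f :: "real ^ 'n \<Rightarrow> real"
  assumes smooth_f: "smooth_on UNIV f" and pos: "\<And>y. f y > 0"
begin

definition u :: "real ^ 'm \<Rightarrow> real" where "u y = f (F y)"
definition D :: "real ^ 'm \<Rightarrow> real" where "D y = frechet_derivative f (at (F y)) (\<xi> y)"
definition d :: "real ^ 'm \<Rightarrow> real ^ 'n" where "d y = flat_gradient f (F y)"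
definition H :: "real ^ 'm \<Rightarrow> real ^ 'n \<Rightarrow> real ^ 'n" where
  "H y = frechet_derivative (flat_gradient f) (at (F y))"
text \<open>The metric that \<open>F\<close> induces from \<open>conformal_metric f\<close>, not the
  ambient Euclidean metric; the one induced from the latter is \<open>g\<close>.\<close>

definition h :: "'m metric" where "h y = (1 / (u y)\<^sup>2) *\<^sub>R g y"

abbreviation tr :: "real ^ 'm \<Rightarrow> ('m \<Rightarrow> 'm \<Rightarrow> 'b::real_vector) \<Rightarrow> 'b" where
  "tr x \<equiv> metric_trace g x"

lemma u_nonzero [simp]: "u x \<noteq> 0"
  using pos[of "F x"] by (simp add: u_def)

lemma differentiable_f: "f differentiable (at y)"
  using smooth_f smooth_on_differentiable by blast

lemma D_eq: "D = (\<lambda>y. d y \<bullet> \<xi> y)"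
  by (simp add: fun_eq_iff D_def d_def inner_flat_gradient differentiable_f)

lemma smooth_u: "smooth_on U u"
  unfolding u_def[abs_def] by (rule smooth_on_compose[OF open_U smooth_F smooth_f])
lemma smooth_d: "smooth_on U d"
  unfolding d_def[abs_def] by (rule smooth_on_compose[OF open_U smooth_F smooth_on_flat_gradient[OF open_UNIV smooth_f]])
lemma smooth_D: "smooth_on U D"
  unfolding D_eq by (rule smooth_on_inner[OF open_U smooth_d smooth_xi])

lemma differentiable_u [simp]: "x \<in> U \<Longrightarrow> u differentiable (at x)"
  by (rule smooth_on_differentiable[OF smooth_u])
lemma differentiable_pd_u [simp]: "x \<in> U \<Longrightarrow> pd i u differentiable (at x)"
  by (rule smooth_on_differentiable[OF smooth_on_pd[OF smooth_u]])
lemma differentiable_d [simp]: "x \<in> U \<Longrightarrow> d differentiable (at x)"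
  by (rule smooth_on_differentiable[OF smooth_d])
lemma differentiable_D [simp]: "x \<in> U \<Longrightarrow> D differentiable (at x)"
  by (rule smooth_on_differentiable[OF smooth_D])
lemma differentiable_pd_D [simp]: "x \<in> U \<Longrightarrow> pd i D differentiable (at x)"
  by (rule smooth_on_differentiable[OF smooth_on_pd[OF smooth_D]])

lemma pd_u: assumes "x \<in> U" shows "pd i u x = d x \<bullet> pd i F x"
proof -
  have "frechet_derivative u (at x) = frechet_derivative f (at (F x)) \<circ> L x"
    unfolding u_def[abs_def] using frechet_derivative_compose[OF differentiable_F[OF assms] differentiable_f] by (simp add: o_def)
  then show ?thesis by (simp add: pd_def[of i u] d_def inner_flat_gradient[OF differentiable_f])
qed

lemma pd_d: assumes "x \<in> U" shows "pd i d x = H x (pd i F x)"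
proof -
  have "frechet_derivative d (at x) = H x \<circ> L x"
    unfolding d_def[abs_def] H_def
    using frechet_derivative_compose[OF differentiable_F[OF assms] smooth_on_differentiable[OF smooth_on_flat_gradient[OF open_UNIV smooth_f]]]
    by (simp add: o_def)
  then show ?thesis by (simp add: pd_def[of i d])
qed

lemma H_symmetric: "H x v \<bullet> w = H x w \<bullet> v"
  using dir_deriv_commute[OF open_UNIV smooth_f, of "F x" v w]
  unfolding H_def by (simp flip: euclidean_hessian_eq[OF smooth_f] add: euclidean_hessian_def)

lemma linear_H: "linear (H x)"
  unfolding H_def
  by (intro linear_frechet_derivative smooth_on_differentiable[OF smooth_on_flat_gradient[OF open_UNIV smooth_f]]) simp

lemma pd_D: "x \<in> U \<Longrightarrow> pd i D x = d x \<bullet> pd i \<xi> x + H x (pd i F x) \<bullet> \<xi> x"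
  unfolding D_eq by (simp add: pd_inner pd_d)

lemma pd_pd_u:
  assumes x: "x \<in> U"
  shows "pd i (pd j u) x = H x (pd i F x) \<bullet> pd j F x + d x \<bullet> pd i (pd j F) x"
proof -
  have "pd i (pd j u) x = pd i (\<lambda>y. d y \<bullet> pd j F y) x"
    by (rule pd_cong[OF _ open_U x]) (use x pd_u in auto)
  then show ?thesis by (simp add: pd_inner x pd_d)
qed

lemma d_decomp: assumes x: "x \<in> U" shows "d x = L x (gradient g u x) + D x *\<^sub>R \<xi> x"
  by (rule tangent_normal_eqI[OF x])
    (simp_all add: x inner_add_left L_gradient pd_u normal D_eq)

lemma d_pd_xi: assumes x: "x \<in> U" shows "d x \<bullet> pd i \<xi> x = - (L x (A x (gradient g u x)) \<bullet> pd i F x)"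
proof -
  have "d x \<bullet> pd i \<xi> x = L x (gradient g u x) \<bullet> pd i \<xi> x"
    by (simp add: d_decomp[OF x] inner_add_left x)
  also have "\<dots> = - (L x (A x (gradient g u x)) \<bullet> L x (axis i 1))"
    by (simp only: pd_xi[OF x] A_self_adjoint[OF x] inner_minus_right)
  finally show ?thesis by simp
qed

text \<open>Differentiating \<open>D = d \<bullet> \<xi>\<close> gives the tangential part of the
  Hessian applied to \<open>\<xi>\<close>: the gradient of \<open>D\<close>, corrected by the
  derivative of \<open>\<xi>\<close>. This is one source of \<open>A (grad f)\<close> in the second
  equation.\<close>

lemma H_xi_decomp:
  assumes x: "x \<in> U"
  shows "H x (\<xi> x) = L x (gradient g D x) + L x (A x (gradient g u x)) + (H x (\<xi> x) \<bullet> \<xi> x) *\<^sub>R \<xi> x"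
  by (rule tangent_normal_eqI[OF x])
    (simp_all add: x inner_add_left L_gradient pd_D normal d_pd_xi H_symmetric[of x "\<xi> x" "pd _ F x"])

text \<open>The Laplacian of \<open>F\<close>, paired with \<open>d\<close>, drops out by
  minimality. What is left is the trace of the ambient Hessian over the tangent space, which is the
  quantity that the curvature term produces.\<close>

lemma laplacian_u: assumes x: "x \<in> U" shows "laplacian g u x = tr x (\<lambda>i j. H x (pd i F x) \<bullet> pd j F x)"
proof -
  have "laplacian g u x = tr x (\<lambda>i j. H x (pd i F x) \<bullet> pd j F x +
     (pd i (pd j F) x - (\<Sum>k\<in>UNIV. christoffel g k i j x *\<^sub>R pd k F x)) \<bullet> d x)"
    unfolding laplacian_def hessian_def
    by (simp add: pd_pd_u x pd_u inner_diff_right inner_sum_right inner_commute algebra_simps)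
  also have "\<dots> = tr x (\<lambda>i j. H x (pd i F x) \<bullet> pd j F x) + divergence g (\<lambda>j. pd j F) x \<bullet> d x"
    unfolding metric_trace_add metric_trace_inner_left divergence_def ..
  finally show ?thesis by (simp add: laplacian_F x)
qed

lemma trace_pd_F:
  assumes x: "x \<in> U"
  shows "tr x (\<lambda>i j. pd i v x *\<^sub>R pd j F x) = L x (gradient g v x)"
    "tr x (\<lambda>i j. pd j v x *\<^sub>R pd i F x) = L x (gradient g v x)"
  using riemannian_point.trace_scaleR_linear[OF riemannian_point_g[OF x] linear_L[OF x], of "\<lambda>i. pd i v x"]
  by (simp_all add: gradient_def)

lemma trace_pd_xi:
  assumes x: "x \<in> U"
  shows "tr x (\<lambda>i j. pd i v x *\<^sub>R pd j \<xi> x) = - L x (A x (gradient g v x))"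
    "tr x (\<lambda>i j. pd j v x *\<^sub>R pd i \<xi> x) = - L x (A x (gradient g v x))"
  using riemannian_point.trace_scaleR_linear[OF riemannian_point_g[OF x] linear_frechet_derivative[OF differentiable_xi[OF x]], of "\<lambda>i. pd i v x"]
  by (simp_all add: gradient_def L_A[OF x] flip: pd_def)

lemma trace_projection:
  assumes x: "x \<in> U"
  shows "tr x (\<lambda>i j. (v \<bullet> pd j F x) *\<^sub>R pd i F x) = v - (v \<bullet> \<xi> x) *\<^sub>R \<xi> x"
proof -
  interpret riemannian_point g x by (rule riemannian_point_g[OF x])
  have "(v - (v \<bullet> \<xi> x) *\<^sub>R \<xi> x) \<bullet> \<xi> x = 0" by (simp add: inner_diff_left x)
  then obtain w where w: "v - (v \<bullet> \<xi> x) *\<^sub>R \<xi> x = L x w" using tangent_iff[OF x] by blast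
  have "v \<bullet> pd j F x = (g x *v w) $ j" for j
  proof -
    have "v \<bullet> pd j F x = (v - (v \<bullet> \<xi> x) *\<^sub>R \<xi> x) \<bullet> pd j F x" by (simp add: inner_diff_left x)
    then show ?thesis unfolding w by (simp add: g_mult[OF x] inner_commute)
  qed
  then have "tr x (\<lambda>i j. (v \<bullet> pd j F x) *\<^sub>R pd i F x) = L x (matrix_inv (g x) *v (g x *v w))"
    using trace_scaleR_linear(2)[OF linear_L[OF x], of "\<lambda>j. (g x *v w) $ j"] by simp
  also have "\<dots> = L x w" by (simp add: matrix_vector_mul_assoc matrix_inv_inverse[OF invertible])
  finally show ?thesis using w by simp
qed

lemma trace_first_form: assumes x: "x \<in> U" shows "tr x (\<lambda>i j. pd i F x \<bullet> pd j F x) = real CARD('m)"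
  using riemannian_point.trace_metric[OF riemannian_point_g[OF x]] by (simp add: g_def)

section \<open>Conformal traces and the tension field\<close>

lemma trace_h:
  assumes x: "x \<in> U"
  shows "metric_trace h x (\<lambda>i j. B i j - (\<Sum>k\<in>UNIV. christoffel h k i j x *\<^sub>R Z k)) =
    (u x)\<^sup>2 *\<^sub>R tr x (\<lambda>i j. B i j - (\<Sum>k\<in>UNIV. christoffel g k i j x *\<^sub>R Z k))
    + ((2 - real CARD('m)) * u x) *\<^sub>R tr x (\<lambda>i j. pd i u x *\<^sub>R Z j)"
proof -
  interpret riemannian_point g x by (rule riemannian_point_g[OF x])
  show ?thesis
    unfolding sum_gradient[symmetric]
    by (rule trace_conformal[OF h_def differentiable_u[OF x] u_nonzero differentiable_g[OF x]])
qed

lemma connection: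
  "connection_term (conformal_metric f) (F x) v w =
    - (1 / u x) *\<^sub>R ((d x \<bullet> v) *\<^sub>R w + (d x \<bullet> w) *\<^sub>R v - (v \<bullet> w) *\<^sub>R d x)"
  unfolding u_def d_def by (rule connection_term_conformal[OF differentiable_f]) (use pos[of "F x"] in simp)

lemma trace_connection:
  assumes x: "x \<in> U"
  shows "tr x (\<lambda>i j. connection_term (conformal_metric f) (F x) (pd i F x) (V j)) = - (1 / u x) *\<^sub>R
    (tr x (\<lambda>i j. pd i u x *\<^sub>R V j) + tr x (\<lambda>i j. (d x \<bullet> V j) *\<^sub>R pd i F x) - tr x (\<lambda>i j. pd i F x \<bullet> V j) *\<^sub>R d x)"
  unfolding connection metric_trace_scaleR pd_u[OF x] metric_trace_diff[of _ _ "\<lambda>i j. _ i j + _ i j"]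
    metric_trace_add metric_trace_scaleR_left ..

text \<open>With the Laplacian of \<open>F\<close> zero, the ambient connection contributes - 2 u
  grad u + m u d and the change of the domain metric contributes (2 - m) u grad u. The tangential
  parts cancel, and m u D remains along \<open>\<xi>\<close>.\<close>

lemma tension_eq:
  assumes x: "x \<in> U"
  shows "tension h (conformal_metric f) F x = (real CARD('m) * (u x * D x)) *\<^sub>R \<xi> x"
proof -
  let ?c = "\<lambda>i j. connection_term (conformal_metric f) (F x) (pd i F x) (pd j F x)"
  have "tr x (\<lambda>i j. cov_along (conformal_metric f) F i (pd j F) x - (\<Sum>k\<in>UNIV. christoffel g k i j x *\<^sub>R pd k F x)) =
      tr x (\<lambda>i j. (pd i (pd j F) x - (\<Sum>k\<in>UNIV. christoffel g k i j x *\<^sub>R pd k F x)) + ?c i j)"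
    by (simp add: cov_along_def algebra_simps)
  also have "\<dots> = - (1 / u x) *\<^sub>R (L x (gradient g u x) + L x (gradient g u x) - real CARD('m) *\<^sub>R d x)"
    unfolding metric_trace_add laplacian_F[OF x, unfolded divergence_def] trace_connection[OF x]
    by (simp add: trace_pd_F x trace_first_form flip: pd_u)
  finally have 1: "tr x (\<lambda>i j. cov_along (conformal_metric f) F i (pd j F) x - (\<Sum>k\<in>UNIV. christoffel g k i j x *\<^sub>R pd k F x))
    = - (1 / u x) *\<^sub>R (L x (gradient g u x) + L x (gradient g u x) - real CARD('m) *\<^sub>R d x)" .
  show ?thesis
    unfolding tension_def trace_h[OF x] 1 trace_pd_F[OF x]
    by (subst d_decomp[OF x], rule inner_eqI, unfold inner_add_right inner_diff_right inner_scaleR_right)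
      (simp add: power2_eq_square field_simps)
qed

text \<open>Up to the factor \<open>m\<close>, the covariant derivative of the tension field.\<close>

definition P :: "'m \<Rightarrow> real ^ 'm \<Rightarrow> real ^ 'n" where
  "P j y = pd j D y *\<^sub>R u y *\<^sub>R \<xi> y + (u y * D y) *\<^sub>R pd j \<xi> y - (D y * D y) *\<^sub>R pd j F y"

lemma differentiable_P: "x \<in> U \<Longrightarrow> P j differentiable (at x)"
  unfolding P_def[abs_def] by simp

text \<open>The product rule yields the derivative of \<open>u\<close> as a coefficient of
  \<open>\<xi>\<close>, which the conformal connection cancels; the pairing of \<open>d\<close> with
  \<open>\<xi>\<close> in that connection produces the square of \<open>D\<close>.\<close>

lemma cov_along_tension:
  assumes x: "x \<in> U"
  shows "cov_along (conformal_metric f) F j (tension h (conformal_metric f) F) x = real CARD('m) *\<^sub>R P j x"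
proof -
  let ?m = "real CARD('m)"
  have "pd j (\<lambda>y. (?m * (u y * D y)) *\<^sub>R \<xi> y) x = pd j (tension h (conformal_metric f) F) x"
    by (rule pd_cong[OF _ open_U x]) (use x tension_eq in auto)
  moreover have "pd j (\<lambda>y. (?m * (u y * D y)) *\<^sub>R \<xi> y) x =
      (?m * (u x * D x)) *\<^sub>R pd j \<xi> x + (?m * (u x * pd j D x + pd j u x * D x)) *\<^sub>R \<xi> x"
    using x by (simp add: pd_scaleR pd_mult)
  moreover have "d x \<bullet> \<xi> x = D x" by (simp add: D_eq)
  ultimately show ?thesis
    unfolding cov_along_def connection tension_eq[OF x] P_def
    by (simp add: x pd_u[symmetric] algebra_simps)
qed

section \<open>Rough Laplacian of the tension field\<close>

lemma trace_u_P:
  assumes x: "x \<in> U"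
  shows "tr x (\<lambda>i j. pd i u x *\<^sub>R P j x) =
    (u x * metric_inner g x (gradient g u x) (gradient g D x)) *\<^sub>R \<xi> x
    - (u x * D x) *\<^sub>R L x (A x (gradient g u x)) - (D x * D x) *\<^sub>R L x (gradient g u x)"
proof -
  have "tr x (\<lambda>i j. pd i u x *\<^sub>R P j x) = tr x (\<lambda>i j. (pd i u x * pd j D x) *\<^sub>R (u x *\<^sub>R \<xi> x)
      + (u x * D x) *\<^sub>R (pd i u x *\<^sub>R pd j \<xi> x) - (D x * D x) *\<^sub>R (pd i u x *\<^sub>R pd j F x))"
    by (simp add: P_def scaleR_add_right scaleR_diff_right mult_ac)
  then show ?thesis
    unfolding metric_trace_diff[of _ _ "\<lambda>i j. _ i j + _ i j"] metric_trace_add metric_trace_scaleR metric_trace_scaleR_left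
      trace_pd_F[OF x] trace_pd_xi[OF x] riemannian_point.trace_prod[OF riemannian_point_g[OF x]]
    by (simp add: mult.commute)
qed

lemma trace_d_P:
  assumes x: "x \<in> U"
  shows "tr x (\<lambda>i j. (d x \<bullet> P j x) *\<^sub>R pd i F x) = (u x * D x) *\<^sub>R L x (gradient g D x)
    - (u x * D x) *\<^sub>R L x (A x (gradient g u x)) - (D x * D x) *\<^sub>R L x (gradient g u x)"
proof -
  have "d x \<bullet> \<xi> x = D x" by (simp add: D_eq)
  then have "tr x (\<lambda>i j. (d x \<bullet> P j x) *\<^sub>R pd i F x) = tr x (\<lambda>i j. (u x * D x) *\<^sub>R (pd j D x *\<^sub>R pd i F x)
      - (u x * D x) *\<^sub>R ((L x (A x (gradient g u x)) \<bullet> pd j F x) *\<^sub>R pd i F x) - (D x * D x) *\<^sub>R (pd j u x *\<^sub>R pd i F x))"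
    by (simp add: P_def inner_add_right inner_diff_right scaleR_left_distrib scaleR_left_diff_distrib d_pd_xi x pd_u mult_ac)
  then show ?thesis
    unfolding metric_trace_diff metric_trace_scaleR trace_pd_F[OF x] trace_projection[OF x]
    by (simp add: normal x)
qed

text \<open>The summand of \<open>P\<close> along \<open>\<xi>\<close> is orthogonal to the frame
  and the one with \<open>pd j \<xi>\<close> has trace zero by minimality; only the first
  fundamental form remains.\<close>

lemma trace_F_P:
  assumes x: "x \<in> U"
  shows "tr x (\<lambda>i j. pd i F x \<bullet> P j x) = - (real CARD('m) * (D x * D x))"
proof -
  have "tr x (\<lambda>i j. pd i F x \<bullet> P j x) =
      tr x (\<lambda>i j. (u x * D x) * (pd i F x \<bullet> pd j \<xi> x) - (D x * D x) * (pd i F x \<bullet> pd j F x))"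
    by (simp add: P_def inner_add_right inner_diff_right x)
  then show ?thesis
    unfolding metric_trace_diff metric_trace_mult trace_first_form[OF x] trace_second_form_0[OF x] by simp
qed

text \<open>Here the Laplacian of \<open>\<xi>\<close> enters. The shape operator applied to the
  gradient of \<open>D\<close> occurs twice, from the derivative of \<open>\<xi>\<close> in the
  first summand of \<open>P\<close> and from that of \<open>D\<close> in the second.\<close>

lemma divergence_P:
  assumes x: "x \<in> U"
  shows "divergence g P x =
    (metric_inner g x (gradient g u x) (gradient g D x) + u x * laplacian g D x
      - u x * D x * trace (matrix (A x \<circ> A x))) *\<^sub>R \<xi> x
    - (2 * u x) *\<^sub>R L x (A x (gradient g D x)) - D x *\<^sub>R L x (A x (gradient g u x))
    - (2 * D x) *\<^sub>R L x (gradient g D x)"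
proof -
  interpret riemannian_point g x by (rule riemannian_point_g[OF x])
  let ?q = "metric_inner g x (gradient g u x) (gradient g D x)"
  \<comment> \<open>The first summand of \<open>P\<close> is read as the scalar one-form dD times
    the vector \<open>u \<xi>\<close>; its bracketing matches this reading.\<close>
  have "tr x (\<lambda>i j. pd j D x *\<^sub>R pd i (\<lambda>y. u y *\<^sub>R \<xi> y) x) =
      tr x (\<lambda>i j. u x *\<^sub>R (pd j D x *\<^sub>R pd i \<xi> x) + (pd i u x * pd j D x) *\<^sub>R \<xi> x)"
    by (simp add: pd_scaleR x scaleR_add_right mult_ac)
  also have "\<dots> = - u x *\<^sub>R L x (A x (gradient g D x)) + ?q *\<^sub>R \<xi> x"
    unfolding metric_trace_add metric_trace_scaleR metric_trace_scaleR_left trace_pd_xi[OF x] trace_prod by simp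
  finally have 1: "divergence g (\<lambda>j y. pd j D y *\<^sub>R (u y *\<^sub>R \<xi> y)) x =
      - u x *\<^sub>R L x (A x (gradient g D x)) + ?q *\<^sub>R \<xi> x + (laplacian g D x * u x) *\<^sub>R \<xi> x"
    by (subst divergence_scaleR_const_vector)
      (simp_all add: x laplacian_eq_divergence)
  have "tr x (\<lambda>i j. pd i (\<lambda>y. u y * D y) x *\<^sub>R pd j \<xi> x) =
      tr x (\<lambda>i j. u x *\<^sub>R (pd i D x *\<^sub>R pd j \<xi> x) + D x *\<^sub>R (pd i u x *\<^sub>R pd j \<xi> x))"
    by (simp add: pd_mult x scaleR_left_distrib mult_ac)
  also have "\<dots> = - u x *\<^sub>R L x (A x (gradient g D x)) - D x *\<^sub>R L x (A x (gradient g u x))"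
    unfolding metric_trace_add metric_trace_scaleR trace_pd_xi[OF x] by simp
  finally have 2: "divergence g (\<lambda>j y. (u y * D y) *\<^sub>R pd j \<xi> y) x =
      - u x *\<^sub>R L x (A x (gradient g D x)) - D x *\<^sub>R L x (A x (gradient g u x))
      - (u x * D x * trace (matrix (A x \<circ> A x))) *\<^sub>R \<xi> x"
    by (subst divergence_scaleR)
      (simp_all add: x laplacian_xi)
  have "tr x (\<lambda>i j. pd i (\<lambda>y. D y * D y) x *\<^sub>R pd j F x) = tr x (\<lambda>i j. (2 * D x) *\<^sub>R (pd i D x *\<^sub>R pd j F x))"
    by (simp add: pd_mult x mult_ac)
  also have "\<dots> = (2 * D x) *\<^sub>R L x (gradient g D x)"
    unfolding metric_trace_scaleR trace_pd_F[OF x] ..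
  finally have 3: "divergence g (\<lambda>j y. (D y * D y) *\<^sub>R pd j F y) x = (2 * D x) *\<^sub>R L x (gradient g D x)"
    by (subst divergence_scaleR)
      (simp_all add: x laplacian_F)
  have "divergence g P x = divergence g (\<lambda>j y. pd j D y *\<^sub>R (u y *\<^sub>R \<xi> y)) x
      + divergence g (\<lambda>j y. (u y * D y) *\<^sub>R pd j \<xi> y) x - divergence g (\<lambda>j y. (D y * D y) *\<^sub>R pd j F y) x"
    unfolding P_def[abs_def]
    by (subst divergence_diff, simp_all add: x) (subst divergence_add, simp_all add: x)
  then show ?thesis unfolding 1 2 3 by (simp add: algebra_simps flip: scaleR_2)
qed

lemma rough_laplacian_eq:
  assumes x: "x \<in> U"
  shows "rough_laplacian h (conformal_metric f) F (tension h (conformal_metric f) F) x = real CARD('m) *\<^sub>R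
    ((u x)\<^sup>2 *\<^sub>R (divergence g P x + tr x (\<lambda>i j. connection_term (conformal_metric f) (F x) (pd i F x) (P j x)))
     + ((2 - real CARD('m)) * u x) *\<^sub>R tr x (\<lambda>i j. pd i u x *\<^sub>R P j x))"
proof -
  let ?m = "real CARD('m)" and ?t = "tension h (conformal_metric f) F"
  have c: "cov_along (conformal_metric f) F i (cov_along (conformal_metric f) F j ?t) x =
      ?m *\<^sub>R (pd i (P j) x + connection_term (conformal_metric f) (F x) (pd i F x) (P j x))" for i j
  proof -
    have "pd i (\<lambda>y. ?m *\<^sub>R P j y) x = pd i (cov_along (conformal_metric f) F j ?t) x"
      by (rule pd_cong[OF _ open_U x]) (use x cov_along_tension differentiable_P in auto)
    then have "pd i (cov_along (conformal_metric f) F j ?t) x = ?m *\<^sub>R pd i (P j) x"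
      using x by (simp add: pd_scaleR differentiable_P)
    then show ?thesis
      unfolding cov_along_def[of _ _ i] cov_along_tension[OF x] connection
      by (simp add: algebra_simps)
  qed
  have "rough_laplacian h (conformal_metric f) F ?t x = metric_trace h x (\<lambda>i j.
      ?m *\<^sub>R ((pd i (P j) x + connection_term (conformal_metric f) (F x) (pd i F x) (P j x))
        - (\<Sum>k\<in>UNIV. christoffel h k i j x *\<^sub>R P k x)))"
    unfolding rough_laplacian_def c cov_along_tension[OF x]
    by (simp add: scaleR_diff_right scaleR_sum_right mult.commute)
  also have "\<dots> = ?m *\<^sub>R ((u x)\<^sup>2 *\<^sub>R tr x (\<lambda>i j.
      (pd i (P j) x + connection_term (conformal_metric f) (F x) (pd i F x) (P j x))
        - (\<Sum>k\<in>UNIV. christoffel g k i j x *\<^sub>R P k x)) + ((2 - ?m) * u x) *\<^sub>R tr x (\<lambda>i j. pd i u x *\<^sub>R P j x))"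
    unfolding metric_trace_scaleR trace_h[OF x] ..
  also have "tr x (\<lambda>i j. (pd i (P j) x + connection_term (conformal_metric f) (F x) (pd i F x) (P j x))
        - (\<Sum>k\<in>UNIV. christoffel g k i j x *\<^sub>R P k x)) = divergence g P x +
      tr x (\<lambda>i j. connection_term (conformal_metric f) (F x) (pd i F x) (P j x))"
    unfolding divergence_def metric_trace_add[symmetric] by (simp add: algebra_simps)
  finally show ?thesis .
qed

text \<open>The tension field is a multiple of \<open>\<xi>\<close>, so its products with the
  coordinate tangent vectors vanish in the curvature formula. The remaining Hessian terms trace to
  the tangential part of the Hessian applied to \<open>\<xi>\<close>, to the Laplacian of
  \<open>u\<close>, and to m times the Hessian applied to \<open>\<xi>\<close>.\<close>

lemma trace_curvature:
  assumes x: "x \<in> U"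
  shows "metric_trace h x (\<lambda>i j. curvature_at (conformal_metric f) (F x) (pd i F x)
      (tension h (conformal_metric f) F x) (pd j F x)) = (real CARD('m) * (u x * D x)) *\<^sub>R
    (u x *\<^sub>R (H x (\<xi> x) - (H x (\<xi> x) \<bullet> \<xi> x) *\<^sub>R \<xi> x - laplacian g u x *\<^sub>R \<xi> x - real CARD('m) *\<^sub>R H x (\<xi> x))
     + (real CARD('m) * (d x \<bullet> d x)) *\<^sub>R \<xi> x)"
proof -
  interpret riemannian_point g x by (rule riemannian_point_g[OF x])
  define a where "a = real CARD('m) * (u x * D x)"
  have fnz: "f y \<noteq> 0" for y using pos[of y] by simp
  have "curvature_at (conformal_metric f) (F x) (pd i F x) (a *\<^sub>R \<xi> x) (pd j F x) =
    (a / u x) *\<^sub>R ((H x (\<xi> x) \<bullet> pd j F x) *\<^sub>R pd i F x - (H x (pd i F x) \<bullet> pd j F x) *\<^sub>R \<xi> x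
       - (pd i F x \<bullet> pd j F x) *\<^sub>R H x (\<xi> x)) + (a * ((d x \<bullet> d x) / (u x)\<^sup>2)) *\<^sub>R ((pd i F x \<bullet> pd j F x) *\<^sub>R \<xi> x)" for i j
    unfolding curvature_at_conformal[OF smooth_f fnz] H_def[symmetric] d_def[symmetric] u_def[symmetric]
    by (simp add: x linear_cmul[OF linear_H] algebra_simps)
  then have "tr x (\<lambda>i j. curvature_at (conformal_metric f) (F x) (pd i F x) (a *\<^sub>R \<xi> x) (pd j F x)) =
    (a / u x) *\<^sub>R ((H x (\<xi> x) - (H x (\<xi> x) \<bullet> \<xi> x) *\<^sub>R \<xi> x) - laplacian g u x *\<^sub>R \<xi> x
       - real CARD('m) *\<^sub>R H x (\<xi> x)) + (a * ((d x \<bullet> d x) / (u x)\<^sup>2)) *\<^sub>R (real CARD('m) *\<^sub>R \<xi> x)"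
    by (simp only: metric_trace_add metric_trace_diff metric_trace_scaleR metric_trace_scaleR_left
        trace_projection[OF x] laplacian_u[OF x] trace_first_form[OF x])
  then show ?thesis
    unfolding tension_eq[OF x] a_def[symmetric] metric_trace_conformal[of h, OF h_def u_nonzero]
    by (simp add: power2_eq_square scaleR_add_right scaleR_diff_right mult_ac)
qed

lemma laplacian_u_D:
  assumes x: "x \<in> U"
  shows "laplacian g (\<lambda>y. u y * D y) x = u x * laplacian g D x
    + 2 * metric_inner g x (gradient g u x) (gradient g D x) + D x * laplacian g u x"
proof -
  interpret riemannian_point g x by (rule riemannian_point_g[OF x])
  have e: "pd i (pd j (\<lambda>y. u y * D y)) x = pd i (\<lambda>y. u y *\<^sub>R pd j D y + pd j u y *\<^sub>R D y) x" for i j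
    by (rule pd_cong[OF _ open_U x, symmetric]) (use x in \<open>auto simp: pd_mult\<close>)
  have "laplacian g (\<lambda>y. u y * D y) x = divergence g (\<lambda>j y. u y *\<^sub>R pd j D y + pd j u y *\<^sub>R D y) x"
    unfolding laplacian_eq_divergence divergence_def e by (simp add: pd_mult x)
  also have "\<dots> = divergence g (\<lambda>j y. u y *\<^sub>R pd j D y) x + divergence g (\<lambda>j y. pd j u y *\<^sub>R D y) x"
    by (rule divergence_add) (simp_all add: x)
  also have "divergence g (\<lambda>j y. u y *\<^sub>R pd j D y) x = tr x (\<lambda>i j. pd i u x * pd j D x) + u x * laplacian g D x"
    by (subst divergence_scaleR) (simp_all add: x laplacian_eq_divergence)
  also have "divergence g (\<lambda>j y. pd j u y *\<^sub>R D y) x = tr x (\<lambda>i j. pd j u x * pd i D x) + laplacian g u x * D x"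
    by (subst divergence_scaleR_const_vector) (simp_all add: x laplacian_eq_divergence)
  also have "tr x (\<lambda>i j. pd j u x * pd i D x) = tr x (\<lambda>i j. pd i u x * pd j D x)"
    by (rule trace_swap)
  finally show ?thesis unfolding trace_prod by (simp add: mult.commute)
qed

lemma metric_inner_u_uD:
  assumes x: "x \<in> U"
  shows "metric_inner g x (gradient g u x) (gradient g (\<lambda>y. u y * D y) x) =
    u x * metric_inner g x (gradient g u x) (gradient g D x)
    + D x * metric_inner g x (gradient g u x) (gradient g u x)"
proof -
  interpret riemannian_point g x by (rule riemannian_point_g[OF x])
  have "tr x (\<lambda>i j. pd i u x * pd j (\<lambda>y. u y * D y) x) =
      tr x (\<lambda>i j. u x * (pd i u x * pd j D x) + D x * (pd i u x * pd j u x))"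
    by (simp add: pd_mult x algebra_simps)
  then show ?thesis
    unfolding metric_trace_add metric_trace_mult trace_prod .
qed

text \<open>Kept in the shape of the theorem, with the Laplacian and the gradient of
  \<open>u D\<close> unexpanded, so that the passage to charts is mere rewriting.\<close>

definition normal_part :: "real ^ 'm \<Rightarrow> real" where
  "normal_part x = u x * laplacian g (\<lambda>y. u y * D y) x
     - real CARD('m) * metric_inner g x (gradient g u x) (gradient g (\<lambda>y. u y * D y) x)
     - (u x)\<^sup>2 * D x * trace (matrix (A x \<circ> A x)) - 2 * real CARD('m) * (D x) ^ 3
     + real CARD('m) * u x * D x * (H x (\<xi> x) \<bullet> \<xi> x)"

definition tangential_part :: "real ^ 'm \<Rightarrow> real ^ 'm" where
  "tangential_part x = (2 * u x) *\<^sub>R A x (gradient g D x)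
     - (2 * (real CARD('m) - 1) * D x) *\<^sub>R A x (gradient g u x)
     + ((4 - real CARD('m)) * D x) *\<^sub>R gradient g D x"

text \<open>Origin of the coefficients: of 2 m D^3 the rough Laplacian and the curvature give one
  half each, the latter through the squared norm of \<open>d\<close>. Of 2 (m - 1) at
  \<open>A (grad u)\<close> each gives m - 1, and 4 - m is 3 from the former plus 1 - m from the
  latter. The curvature also supplies \<open>D\<close> times the Laplacian of \<open>u\<close>,
  which completes the Laplacian of \<open>u D\<close>. The tangential terms in grad u without
  \<open>A\<close> cancel.\<close>

lemma bitension_eq:
  assumes x: "x \<in> U"
  shows "bitension h (conformal_metric f) F x =
    real CARD('m) *\<^sub>R ((u x * normal_part x) *\<^sub>R \<xi> x - (u x)\<^sup>2 *\<^sub>R L x (tangential_part x))"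
proof -
  define m where "m = real CARD('m)"
  define q where "q = metric_inner g x (gradient g u x) (gradient g D x)"
  define Q where "Q = metric_inner g x (gradient g u x) (gradient g u x)"
  define gu gD AU AD where "gu = L x (gradient g u x)" and "gD = L x (gradient g D x)"
    and "AU = L x (A x (gradient g u x))" and "AD = L x (A x (gradient g D x))"
  define lu lD T k where "lu = laplacian g u x" and "lD = laplacian g D x"
    and "T = trace (matrix (A x \<circ> A x))" and "k = H x (\<xi> x) \<bullet> \<xi> x"
  note defs = m_def q_def Q_def gu_def gD_def AU_def AD_def lu_def lD_def T_def k_def
  note folds = defs[symmetric]
  have d: "d x = gu + D x *\<^sub>R \<xi> x" unfolding gu_def by (rule d_decomp[OF x])
  have Hx: "H x (\<xi> x) = gD + AU + k *\<^sub>R \<xi> x" unfolding gD_def AU_def k_def by (rule H_xi_decomp[OF x])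
  have dd: "d x \<bullet> d x = Q + D x * D x"
    unfolding d Q_def metric_inner_g[OF x] gu_def by (simp add: inner_add_left inner_add_right normal x)
  have rough: "rough_laplacian h (conformal_metric f) F (tension h (conformal_metric f) F) x = m *\<^sub>R
    ((u x)\<^sup>2 *\<^sub>R (((q + u x * lD - u x * D x * T) *\<^sub>R \<xi> x - (2 * u x) *\<^sub>R AD - D x *\<^sub>R AU - (2 * D x) *\<^sub>R gD)
       + - (1 / u x) *\<^sub>R (((u x * q) *\<^sub>R \<xi> x - (u x * D x) *\<^sub>R AU - (D x * D x) *\<^sub>R gu)
          + ((u x * D x) *\<^sub>R gD - (u x * D x) *\<^sub>R AU - (D x * D x) *\<^sub>R gu)
          - (- (m * (D x * D x))) *\<^sub>R (gu + D x *\<^sub>R \<xi> x)))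
     + ((2 - m) * u x) *\<^sub>R ((u x * q) *\<^sub>R \<xi> x - (u x * D x) *\<^sub>R AU - (D x * D x) *\<^sub>R gu))"
    unfolding rough_laplacian_eq[OF x] divergence_P[OF x] trace_connection[OF x] trace_u_P[OF x]
      trace_d_P[OF x] trace_F_P[OF x] folds unfolding d ..
  have curv: "metric_trace h x (\<lambda>i j. curvature_at (conformal_metric f) (F x) (pd i F x)
      (tension h (conformal_metric f) F x) (pd j F x)) = (m * (u x * D x)) *\<^sub>R
    (u x *\<^sub>R ((gD + AU + k *\<^sub>R \<xi> x) - k *\<^sub>R \<xi> x - lu *\<^sub>R \<xi> x - m *\<^sub>R (gD + AU + k *\<^sub>R \<xi> x))
     + (m * (Q + D x * D x)) *\<^sub>R \<xi> x)"
    unfolding trace_curvature[OF x] folds dd unfolding Hx ..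
  have N: "normal_part x = u x * (u x * lD + 2 * q + D x * lu) - m * (u x * q + D x * Q)
     - (u x)\<^sup>2 * D x * T - 2 * m * (D x) ^ 3 + m * u x * D x * k"
    unfolding normal_part_def laplacian_u_D[OF x] metric_inner_u_uD[OF x] folds ..
  have TT: "L x (tangential_part x) = (2 * u x) *\<^sub>R AD - (2 * (m - 1) * D x) *\<^sub>R AU + ((4 - m) * D x) *\<^sub>R gD"
    unfolding tangential_part_def linear_add[OF linear_L[OF x]] linear_diff[OF linear_L[OF x]]
      linear_cmul[OF linear_L[OF x]] folds ..
  \<comment> \<open>The only division left. Given \<open>p * u x = 1\<close>, the claim is a
    polynomial identity in the products with a test vector.\<close>
  define p where "p = 1 / u x"
  have p: "p * u x = 1" by (simp add: p_def)
  show ?thesis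
    unfolding bitension_def rough curv N TT folds p_def[symmetric]
  proof (rule inner_eqI, goal_cases)
    case (1 z)
    show ?case
      unfolding inner_add_right inner_diff_right inner_scaleR_right inner_minus_right
      using p by algebra
  qed
qed

text \<open>The two parts vanish separately because \<open>\<xi>\<close> is a unit normal and the
  differential is injective; \<open>u\<close> is nonzero, and m is positive as the cardinality of a
  type.\<close>

lemma bitension_eq_0_iff:
  assumes x: "x \<in> U"
  shows "bitension h (conformal_metric f) F x = 0 \<longleftrightarrow> normal_part x = 0 \<and> tangential_part x = 0"
proof
  assume "bitension h (conformal_metric f) F x = 0"
  then have 0: "(u x * normal_part x) *\<^sub>R \<xi> x = (u x)\<^sup>2 *\<^sub>R L x (tangential_part x)"
    unfolding bitension_eq[OF x] by simp
  have "((u x * normal_part x) *\<^sub>R \<xi> x) \<bullet> \<xi> x = 0" unfolding 0 by (simp add: normal x)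
  then have N: "normal_part x = 0" by (simp add: x)
  with 0 have "L x (tangential_part x) = L x 0" by (simp add: linear_0[OF linear_L[OF x]])
  then show "normal_part x = 0 \<and> tangential_part x = 0" using N inj[OF x] by (simp add: inj_eq)
next
  assume "normal_part x = 0 \<and> tangential_part x = 0"
  then show "bitension h (conformal_metric f) F x = 0"
    unfolding bitension_eq[OF x] by (simp add: linear_0[OF linear_L[OF x]])
qed

end

section \<open>Passage to charts\<close>

lemma shape_operator_eq:
  "shape_operator \<phi> \<xi> c = hypersurface_patch.A (local_rep c \<phi>) (local_rep c \<xi>)"
  if "hypersurface_patch U (local_rep c \<phi>) (local_rep c \<xi>)"
  using hypersurface_patch.A_def[OF that] by (simp add: fun_eq_iff shape_operator_def)

text \<open>\<open>local_rep\<close> inverts a chart by choice; injectivity, taken from the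
  homeomorphism, makes this a true inverse.\<close>

lemma inv_into_chart:
  assumes "smooth_manifold M \<A>" "c \<in> \<A>" "p \<in> fst c"
  shows "inv_into (fst c) (snd c) (snd c p) = p"
proof -
  have "openin M (fst c)"
    and hom: "homeomorphic_map (subtopology M (fst c)) (top_of_set (chart_image c)) (snd c)"
    using assms by (auto simp: smooth_manifold_def)
  then have "topspace (subtopology M (fst c)) = fst c"
    by (auto dest: openin_subset)
  then have "inj_on (snd c) (fst c)"
    using homeomorphic_imp_injective_map[OF hom] by simp
  then show ?thesis using assms(3) by simp
qed

lemma conformal_patch_chart:
  fixes \<phi> \<xi> :: "'a \<Rightarrow> real ^ 'n::finite" and \<A> :: "('a, 'm::finite) chart set"
  assumes f: "smooth_on UNIV f" "\<And>y. f y > 0" and "CARD('n) = CARD('m) + 1"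
    and M: "smooth_manifold M \<A>" and "immersion \<A> \<phi>" "unit_normal_field \<A> \<phi> \<xi>"
    and min: "minimal_hypersurface \<A> \<phi> \<xi>" and c: "c \<in> \<A>"
  shows "conformal_patch (chart_image c) (local_rep c \<phi>) (local_rep c \<xi>) f"
proof -
  have ex: "\<exists>p\<in>fst c. x = snd c p \<and> local_rep c \<xi> x = \<xi> p" if "x \<in> chart_image c" for x
    using that inv_into_chart[OF M c] by (auto simp: chart_image_def local_rep_def)
  interpret hypersurface_patch "chart_image c" "local_rep c \<phi>" "local_rep c \<xi>"
  proof
    show "open (chart_image c)" using M c by (simp add: smooth_manifold_def)
    show "smooth_on (chart_image c) (local_rep c \<phi>)" "smooth_on (chart_image c) (local_rep c \<xi>)"
      using assms by (auto simp: immersion_def unit_normal_field_def smooth_map_def)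
    show "inj (frechet_derivative (local_rep c \<phi>) (at x))" if "x \<in> chart_image c" for x
      using assms that by (auto simp: immersion_def)
    show "norm (local_rep c \<xi> x) = 1"
      "frechet_derivative (local_rep c \<phi>) (at x) v \<bullet> local_rep c \<xi> x = 0" if "x \<in> chart_image c" for x v
      using assms ex[OF that] by (auto simp: unit_normal_field_def)
  qed fact
  show ?thesis
  proof
    show "trace (matrix (A x)) = 0" if "x \<in> chart_image c" for x
    proof -
      \<comment> \<open>\<open>mean_curvature\<close> is the trace divided by the positive
        dimension, so its vanishing is that of the trace.\<close>
      have "mean_curvature \<phi> \<xi> c x = 0" using min c that by (simp add: minimal_hypersurface_def)
      then show ?thesis by (simp add: mean_curvature_def shape_operator_eq[OF hypersurface_patch_axioms])
    qed
  qed (use f in auto)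
qed

theorem theorem2p5:
  fixes M :: "'a topology" and \<A> :: "('a, 'm::finite) chart set"
    and f :: "real ^ 'n::finite \<Rightarrow> real" and \<phi> \<xi> :: "'a \<Rightarrow> real ^ 'n" and m :: nat
  assumes "CARD('m) = m" and "CARD('n) = m + 1"
    and "smooth_on UNIV f" and "\<And>y. f y > 0"
    and "smooth_manifold M \<A>"
    and "immersion \<A> \<phi>"
    and "unit_normal_field \<A> \<phi> \<xi>"
    and "minimal_hypersurface \<A> \<phi> \<xi>"
  shows "biharmonic_hypersurface \<A> (conformal_metric f) \<phi> \<longleftrightarrow>
    (\<forall>c\<in>\<A>. \<forall>p\<in>fst c.
      let x = snd c p;
          g = induced_metric flat_metric \<phi> c;
          \<Delta> = (\<lambda>u. laplacian g (local_rep c u) x);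
          grad = (\<lambda>u. gradient g (local_rep c u) x);
          A = shape_operator \<phi> \<xi> c x;
          F = (\<lambda>q. f (\<phi> q));
          D = normal_derivative f \<phi> \<xi>
      in F p * \<Delta> (\<lambda>q. F q * D q)
           - real m * metric_inner g x (grad F) (grad (\<lambda>q. F q * D q))
           - (F p)\<^sup>2 * D p * trace (matrix (A \<circ> A))
           - 2 * real m * (D p) ^ 3
           + real m * F p * D p * euclidean_hessian f (\<phi> p) (\<xi> p) (\<xi> p) = 0
       \<and> (2 * F p) *\<^sub>R A (grad D)
           - (2 * (real m - 1) * D p) *\<^sub>R A (grad F)
           + ((4 - real m) * D p) *\<^sub>R grad D = 0)"
proof -
  \<comment> \<open>Biharmonicity ranges over coordinates in the image of a chart, the two equations
    over points \<open>p\<close>; they are compared at the coordinates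
    \<open>snd c p\<close>.\<close>
  have chart: "bitension (induced_metric (conformal_metric f) \<phi> c) (conformal_metric f) (local_rep c \<phi>) (snd c p) = 0 \<longleftrightarrow>
    (let x = snd c p;
          g = induced_metric flat_metric \<phi> c;
          \<Delta> = (\<lambda>u. laplacian g (local_rep c u) x);
          grad = (\<lambda>u. gradient g (local_rep c u) x);
          A = shape_operator \<phi> \<xi> c x;
          F = (\<lambda>q. f (\<phi> q));
          D = normal_derivative f \<phi> \<xi>
      in F p * \<Delta> (\<lambda>q. F q * D q)
           - real m * metric_inner g x (grad F) (grad (\<lambda>q. F q * D q))
           - (F p)\<^sup>2 * D p * trace (matrix (A \<circ> A))
           - 2 * real m * (D p) ^ 3
           + real m * F p * D p * euclidean_hessian f (\<phi> p) (\<xi> p) (\<xi> p) = 0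
       \<and> (2 * F p) *\<^sub>R A (grad D)
           - (2 * (real m - 1) * D p) *\<^sub>R A (grad F)
           + ((4 - real m) * D p) *\<^sub>R grad D = 0)"
    if c: "c \<in> \<A>" and p: "p \<in> fst c" for c p
  proof -
    interpret conformal_patch "chart_image c" "local_rep c \<phi>" "local_rep c \<xi>" f
      using assms c by (intro conformal_patch_chart) auto
    have x: "snd c p \<in> chart_image c" using p by (simp add: chart_image_def)
    have inv: "inv_into (fst c) (snd c) (snd c p) = p" by (rule inv_into_chart[OF assms(5) c p])
    have g: "induced_metric flat_metric \<phi> c = g"
      by (simp add: fun_eq_iff induced_metric_def metric_inner_def flat_metric_def g_def)
    have h: "induced_metric (conformal_metric f) \<phi> c = h"
      by (simp add: fun_eq_iff vec_eq_iff induced_metric_def metric_inner_def conformal_metric_def flat_metric_def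
          g_def h_def u_def matrix_vector_mult_scaleR scaleR_matrix_vector_assoc[symmetric])
    have lu: "local_rep c (\<lambda>q. f (\<phi> q)) = u" and lD: "local_rep c (normal_derivative f \<phi> \<xi>) = D"
      and luD: "local_rep c (\<lambda>q. f (\<phi> q) * normal_derivative f \<phi> \<xi> q) = (\<lambda>y. u y * D y)"
      unfolding fun_eq_iff u_def D_def by (simp_all add: local_rep_def normal_derivative_def)
    have up: "f (\<phi> p) = u (snd c p)" and Dp: "normal_derivative f \<phi> \<xi> p = D (snd c p)"
      and hp: "euclidean_hessian f (\<phi> p) (\<xi> p) (\<xi> p) =
        H (snd c p) (local_rep c \<xi> (snd c p)) \<bullet> local_rep c \<xi> (snd c p)"
      unfolding u_def D_def H_def euclidean_hessian_eq[OF smooth_f]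
      by (simp_all add: local_rep_def normal_derivative_def inv)
    show ?thesis
      unfolding Let_def g h lu lD luD up Dp hp shape_operator_eq[OF hypersurface_patch_axioms]
        bitension_eq_0_iff[OF x] normal_part_def tangential_part_def assms(1) ..
  qed
  show ?thesis
    unfolding biharmonic_hypersurface_def biharmonic_map_def
    using chart by (simp add: chart_image_def)
qed

end
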